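(* Let $f:2^{\mathcal U}\to\mathbb{R}_{\ge0}$ be submodular on a ground set $\mathcal U$ with $|\mathcal U|=n$, given by a value oracle, let $0<\epsilon<1$, let $k$ be a positive integer and $O\in\arg\max_{S\subseteq\mathcal U,|S|\le k}f(S)$. Let $\ell$ be a positive integer with $\ell=O(\epsilon^{-1})$ and $\ell\ge\frac{4}{e\epsilon}$, and suppose $k\ge\frac{(2-\epsilon)^2\ell}{e\epsilon\ell-4}$. There is a randomized algorithm (the paper's ParallelInterpolatedGreedy) which, on input $(f,k,\epsilon)$ with parameter $\ell$, returns a set $G\subseteq\mathcal U$ with $|G|\le k$ and $\mathbb{E}[f(G)]\ge(1/e-\epsilon)f(O)$, and with probability $1-O(1/(\epsilon n))$ uses $O(\epsilon^{-5}\log(n)\log(k))$ adaptive rounds and $O(\epsilon^{-6}n\log(n)\log(k))$ oracle queries.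
   Context: A set function $f$ is submodular if $f(X)+f(Y)\ge f(X\cup Y)+f(X\cap Y)$ for all $X,Y$; $f$ is not assumed monotone. Query complexity is the total number of evaluations of $f$. Adaptive rounds: the oracle queries of the algorithm are partitioned into sequential rounds, such that the sets queried in a round may depend only on answers to queries from earlier rounds; adaptivity is the number of rounds. Expectation is over the algorithm's random choices. *)

theory Defs
  imports "HOL-Probability.Probability"
begin

definition submodular_on :: "'a set \<Rightarrow> ('a set \<Rightarrow> real) \<Rightarrow> bool" where
  "submodular_on U f \<longleftrightarrow>
     (\<forall>X Y. X \<subseteq> U \<longrightarrow> Y \<subseteq> U \<longrightarrow> f X + f Y \<ge> f (X \<union> Y) + f (X \<inter> Y))"

text \<open>
  Randomized parallel algorithms with access to a set-function oracle, as decision trees.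
  \<open>Query Qs c\<close> is one adaptive round: the whole batch \<open>Qs\<close> is fixed before any of its answers
  is known, and the algorithm continues as \<open>c ys\<close>, where \<open>ys\<close> lists the answers. The tree does not
  mention the oracle function, so the answers are the only information about it.
\<close>

datatype 'a oracle_alg =
    Return "'a set"
  | Flip "'a oracle_alg pmf"
  | Query "'a set list" "real list \<Rightarrow> 'a oracle_alg"

inductive queries_within :: "'a set \<Rightarrow> 'a oracle_alg \<Rightarrow> bool" for U where
  "queries_within U (Return G)"
| "(\<forall>A\<in>set_pmf p. queries_within U A) \<Longrightarrow> queries_within U (Flip p)"
| "(\<forall>Q\<in>set Qs. Q \<subseteq> U) \<Longrightarrow> (\<forall>ys. queries_within U (c ys)) \<Longrightarrow> queries_within U (Query Qs c)"

text \<open>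
  Joint distribution of (returned set, number of adaptive rounds, number of oracle queries);
  repeated evaluations of the same set are counted each time.
\<close>

primrec run :: "('a set \<Rightarrow> real) \<Rightarrow> 'a oracle_alg \<Rightarrow> ('a set \<times> nat \<times> nat) pmf" where
  "run f (Return G) = return_pmf (G, 0, 0)"
| "run f (Flip p) = join_pmf (map_pmf (run f) p)"
| "run f (Query Qs c) =
     map_pmf (\<lambda>(G, r, q). (G, r + 1, q + length Qs)) (run f (c (map f Qs)))"

end

theory Submission
  imports Defs
begin

text \<open>
  The solution is built in stages. A stage replaces \<open>G\<close> by a random \<open>G'\<close> such that, with
  \<open>t = 1 - 1 / l\<close>, every element joins with probability at most \<open>1 / l\<close>, hence
  \<open>E f(O \<union> G') \<ge> t f(O \<union> G)\<close>, and \<open>E f(G') \<ge> t f(G) + (\<beta> / l) t\<^sup>2 f(O \<union> G)\<close>. After \<open>l\<close> stages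
  this yields \<open>\<beta> t^(l+1) f(O)\<close>, and \<open>t^(l+1)\<close> tends to \<open>1 / e\<close>.

  If \<open>k\<close> is at most of order \<open>ln k / \<epsilon>^3\<close>, a stage is one step of random greedy and \<open>l = k\<close>.
  Otherwise \<open>l\<close> is about \<open>2 / \<epsilon>\<close>, and a stage considers about \<open>k\<close> elements in blocks of size \<open>l\<close>, one
  random member of each block being accepted. The blocks are random subsets of the candidates whose
  marginal gain exceeds a threshold, and the threshold decreases geometrically. Many blocks are
  drawn at once; the longest useful prefix is found by testing prefixes of geometrically growing
  length, and a batch ends as soon as a \<open>\<delta>\<close>-fraction of the candidates has dropped below the
  threshold. Before that moment a random block is mostly good, so the expected gain of an accepted
  element is nearly the threshold; and each batch shrinks the candidates by a constant factor, so
  both costs are bounded in the worst case and not only with high probability.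

  The parameter \<open>l\<close> of the statement serves only to guarantee \<open>k * e * \<epsilon> \<ge> 2\<close>; the algorithm itself
  chooses its number of stages, called \<open>l\<close> from here on.
\<close>

section \<open>Oracle programs\<close>

text \<open>
  \<^typ>\<open>'a oracle_alg\<close> returns sets only and hence cannot be composed sequentially. Programs return
  values of any type, and those that return a set compile to \<^typ>\<open>'a oracle_alg\<close>.
\<close>

datatype ('a, 'b) program =
    Done 'b
  | Sample "('a, 'b) program pmf"
  | Ask "'a set list" "real list \<Rightarrow> ('a, 'b) program"

primrec bind_program :: "('a, 'b) program \<Rightarrow> ('b \<Rightarrow> ('a, 'c) program) \<Rightarrow> ('a, 'c) program" where
  "bind_program (Done b) k = k b"
| "bind_program (Sample p) k = Sample (map_pmf (\<lambda>P. bind_program P k) p)"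
| "bind_program (Ask Qs c) k = Ask Qs (\<lambda>ys. bind_program (c ys) k)"

adhoc_overloading Monad_Syntax.bind \<rightleftharpoons> bind_program

primrec outcome :: "('a set \<Rightarrow> real) \<Rightarrow> ('a, 'b) program \<Rightarrow> 'b pmf" where
  "outcome f (Done b) = return_pmf b"
| "outcome f (Sample p) = join_pmf (map_pmf (outcome f) p)"
| "outcome f (Ask Qs c) = outcome f (c (map f Qs))"

primrec cost_le :: "('a set \<Rightarrow> real) \<Rightarrow> ('a, 'b) program \<Rightarrow> real \<Rightarrow> real \<Rightarrow> bool" where
  "cost_le f (Done b) = (\<lambda>R Q. 0 \<le> R \<and> 0 \<le> Q)"
| "cost_le f (Sample p) = (\<lambda>R Q. \<forall>C\<in>set_pmf (map_pmf (cost_le f) p). C R Q)"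
| "cost_le f (Ask Qs c) = (\<lambda>R Q. cost_le f (c (map f Qs)) (R - 1) (Q - real (length Qs)))"

primrec legal :: "'a set \<Rightarrow> ('a, 'b) program \<Rightarrow> bool" where
  "legal U (Done b) \<longleftrightarrow> True"
| "legal U (Sample p) \<longleftrightarrow> (\<forall>L\<in>set_pmf (map_pmf (legal U) p). L)"
| "legal U (Ask Qs c) \<longleftrightarrow> (\<forall>Q\<in>set Qs. Q \<subseteq> U) \<and> (\<forall>ys. legal U (c ys))"

lemma outcome_bind [simp]: "outcome f (P \<bind> k) = outcome f P \<bind> (\<lambda>b. outcome f (k b))"
proof (induction P)
  case (Sample p)
  then show ?case
    by (simp add: join_pmf_def bind_map_pmf bind_assoc_pmf cong: bind_pmf_cong)
qed (simp_all add: bind_return_pmf)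

lemma cost_le_mono: "cost_le f P R Q \<Longrightarrow> R \<le> R' \<Longrightarrow> Q \<le> Q' \<Longrightarrow> cost_le f P R' Q'"
proof (induction P arbitrary: R Q R' Q')
  case (Ask Qs c)
  show ?case using Ask.prems by (auto intro: Ask.IH)
qed auto

lemma cost_le_bind:
  assumes "cost_le f P R Q" "\<And>b. b \<in> set_pmf (outcome f P) \<Longrightarrow> cost_le f (k b) R' Q'"
  shows "cost_le f (P \<bind> k) (R + R') (Q + Q')"
  using assms
proof (induction P arbitrary: R Q)
  case (Done b)
  then show ?case by (auto intro: cost_le_mono)
next
  case (Sample p)
  then show ?case by (fastforce simp: join_pmf_def)
next
  case (Ask Qs c)
  then have "cost_le f (c (map f Qs) \<bind> k) (R - 1 + R') (Q - length Qs + Q')" by (intro Ask.IH) auto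
  then show ?case by (simp add: algebra_simps)
qed

lemma legal_bind: "legal U P \<Longrightarrow> (\<And>b. legal U (k b)) \<Longrightarrow> legal U (P \<bind> k)"
  by (induction P) auto

definition sample :: "'b pmf \<Rightarrow> ('a, 'b) program" where
  "sample p = Sample (map_pmf Done p)"

lemma outcome_sample [simp]: "outcome f (sample p) = p"
  by (simp add: sample_def map_pmf_comp join_pmf_def bind_map_pmf bind_return_pmf')

lemma cost_le_sample: "cost_le f (sample p) 0 0"
  by (simp add: sample_def)

lemma legal_sample: "legal U (sample p)"
  by (simp add: sample_def)

text \<open>
  Intersecting with \<open>U\<close> keeps every query legal even along branches whose answers no set function
  produces.
\<close>

definition query :: "'a set \<Rightarrow> 'a set list \<Rightarrow> ('a, 'a set \<Rightarrow> real) program" where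
  "query U Qs = Ask (map (\<lambda>S. S \<inter> U) Qs)
     (\<lambda>ys. Done (\<lambda>S. case map_of (zip Qs ys) S of Some y \<Rightarrow> y | None \<Rightarrow> 0))"

lemma legal_query: "legal U (query U Qs)"
  by (simp add: query_def)

lemma query_answers:
  assumes "\<And>S. S \<in> set Qs \<Longrightarrow> S \<subseteq> U"
  obtains g where "\<And>S. S \<in> set Qs \<Longrightarrow> g S = f S" "outcome f (query U Qs) = return_pmf g"
proof
  let ?ys = "map f (map (\<lambda>S. S \<inter> U) Qs)"
  let ?g = "\<lambda>S. case map_of (zip Qs ?ys) S of Some y \<Rightarrow> y | None \<Rightarrow> 0"
  show "?g S = f S" if "S \<in> set Qs" for S
    using that assms by (simp add: map_of_zip_map Int_absorb2)
  show "outcome f (query U Qs) = return_pmf ?g"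
    by (simp add: query_def)
qed

lemma cost_le_query: "cost_le f (query U Qs) 1 (length Qs)"
  by (simp add: query_def)

lemma outcome_query_bind:
  assumes "\<And>S. S \<in> set Qs \<Longrightarrow> S \<subseteq> U" "\<And>g. (\<And>S. S \<in> set Qs \<Longrightarrow> g S = f S) \<Longrightarrow> k g = k f"
  shows "outcome f (query U Qs \<bind> k) = outcome f (k f)"
  using query_answers[OF assms(1)] assms(2) by (metis bind_return_pmf outcome_bind)

lemma cost_le_query_bind:
  assumes "\<And>S. S \<in> set Qs \<Longrightarrow> S \<subseteq> U" "\<And>g. (\<And>S. S \<in> set Qs \<Longrightarrow> g S = f S) \<Longrightarrow> k g = k f"
    and "cost_le f (k f) R Q"
  shows "cost_le f (query U Qs \<bind> k) (1 + R) (real (length Qs) + Q)"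
proof (rule cost_le_bind[OF cost_le_query])
  fix h assume "h \<in> set_pmf (outcome f (query U Qs))"
  moreover obtain g where "\<And>S. S \<in> set Qs \<Longrightarrow> g S = f S" "outcome f (query U Qs) = return_pmf g"
    using query_answers[OF assms(1)] by blast
  ultimately show "cost_le f (k h) R Q" using assms(2)[of g] assms(3) by simp
qed

primrec iterate :: "nat \<Rightarrow> ('b \<Rightarrow> ('a, 'b) program) \<Rightarrow> 'b \<Rightarrow> ('a, 'b) program" where
  "iterate 0 P x = Done x"
| "iterate (Suc n) P x = P x \<bind> iterate n P"

lemma legal_iterate: "(\<And>x. legal U (P x)) \<Longrightarrow> legal U (iterate n P x)"
  by (induction n arbitrary: x) (auto intro: legal_bind)

lemma iterate_invariant:
  assumes "\<And>i x y. I i x \<Longrightarrow> y \<in> set_pmf (outcome f (P x)) \<Longrightarrow> I (Suc i) y"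
    and "I i x" "y \<in> set_pmf (outcome f (iterate n P x))"
  shows "I (i + n) y"
  using assms(2,3)
proof (induction n arbitrary: i x)
  case (Suc n)
  then obtain x' where "x' \<in> set_pmf (outcome f (P x))" "y \<in> set_pmf (outcome f (iterate n P x'))"
    by auto
  then show ?case using Suc.IH[of "Suc i" x'] Suc.prems(1) assms(1) by simp
qed simp

text \<open>Amortized costs: \<open>\<phi> n x\<close> pays for the queries of the remaining \<open>n\<close> rounds of the loop.\<close>

lemma cost_le_iterate:
  assumes "\<And>x. I x \<Longrightarrow> cost_le f (P x) R (Q x)"
    and "\<And>x y. I x \<Longrightarrow> y \<in> set_pmf (outcome f (P x)) \<Longrightarrow> I y"
    and "\<And>n x y. I x \<Longrightarrow> y \<in> set_pmf (outcome f (P x)) \<Longrightarrow> Q x + \<phi> n y \<le> \<phi> (Suc n) x"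
    and "\<And>x. I x \<Longrightarrow> 0 \<le> \<phi> 0 x" "I x"
  shows "cost_le f (iterate n P x) (n * R) (\<phi> n x)"
  using assms(5)
proof (induction n arbitrary: x)
  case (Suc n)
  have "cost_le f (P x \<bind> iterate n P) (R + n * R) (Q x + (\<phi> (Suc n) x - Q x))"
  proof (rule cost_le_bind[OF assms(1)[OF Suc.prems]])
    fix y assume y: "y \<in> set_pmf (outcome f (P x))"
    show "cost_le f (iterate n P y) (n * R) (\<phi> (Suc n) x - Q x)"
      using Suc.IH[OF assms(2)[OF Suc.prems y]] assms(3)[OF Suc.prems y, of n]
      by (auto intro: cost_le_mono)
  qed
  then show ?case by (simp add: distrib_right)
qed (simp add: assms(4))

primrec compile :: "('a, 'a set) program \<Rightarrow> 'a oracle_alg" where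
  "compile (Done G) = Return G"
| "compile (Sample p) = Flip (map_pmf compile p)"
| "compile (Ask Qs c) = Query Qs (\<lambda>ys. compile (c ys))"

lemma queries_within_compile: "legal U P \<Longrightarrow> queries_within U (compile P)"
  by (induction P) (auto intro!: queries_within.intros)

lemma map_fst_run_compile: "map_pmf fst (run f (compile P)) = outcome f P"
proof (induction P)
  case (Sample p)
  then show ?case
    by (simp add: join_pmf_def bind_map_pmf map_bind_pmf cong: bind_pmf_cong)
next
  case (Ask Qs c)
  then show ?case by (simp add: map_pmf_comp case_prod_beta)
qed simp

lemma cost_run_compile:
  assumes "cost_le f P R Q" "(G, r, q) \<in> set_pmf (run f (compile P))"
  shows "real r \<le> R \<and> real q \<le> Q"
  using assms
proof (induction P arbitrary: R Q G r q)
  case (Sample p)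
  then show ?case by (fastforce simp: join_pmf_def)
next
  case (Ask Qs c)
  then obtain r' q' where "(G, r', q') \<in> set_pmf (run f (compile (c (map f Qs))))"
    "r = r' + 1" "q = q' + length Qs" by auto
  moreover from this(1) have "real r' \<le> R - 1 \<and> real q' \<le> Q - length Qs"
    using Ask.prems(1) by (intro Ask.IH[OF rangeI]) auto
  ultimately show ?case by auto
qed simp

lemma outcome_run_compile: "(G, r, q) \<in> set_pmf (run f (compile P)) \<Longrightarrow> G \<in> set_pmf (outcome f P)"
  unfolding map_fst_run_compile[symmetric] by force

lemma expectation_run_compile:
  fixes h :: "'a set \<Rightarrow> real"
  shows "measure_pmf.expectation (run f (compile P)) (\<lambda>(G, r, q). h G)
    = measure_pmf.expectation (outcome f P) h"
proof -
  have "(\<lambda>(G, r, q). h G) = (\<lambda>x :: 'a set \<times> nat \<times> nat. h (fst x))" by auto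
  then show ?thesis
    using integral_map_pmf[of fst "run f (compile P)" h] by (simp add: map_fst_run_compile)
qed

lemma prob_cost_run_compile_ge:
  assumes cost: "\<pi> < 1 \<Longrightarrow> cost_le f P R Q" and "0 \<le> \<pi>"
  shows "1 - \<pi> \<le> measure_pmf.prob (run f (compile P)) {(G, r, q). real r \<le> R \<and> real q \<le> Q}"
proof (cases "\<pi> < 1")
  case True
  have "measure_pmf.prob (run f (compile P)) {(G, r, q). real r \<le> R \<and> real q \<le> Q} = 1"
    using cost_run_compile[OF cost[OF True]]
    by (subst measure_pmf.prob_eq_1) (auto simp: AE_measure_pmf_iff)
  then show ?thesis using assms(2) by simp
next
  case False
  then have "1 - \<pi> \<le> 0" by simp
  then show ?thesis using measure_nonneg order_trans by blast
qed

section \<open>Expectations of finitely supported distributions\<close>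

abbreviation expect :: "'b pmf \<Rightarrow> ('b \<Rightarrow> real) \<Rightarrow> real" where
  "expect p h \<equiv> measure_pmf.expectation p h"

lemma expect_bind:
  assumes "finite (set_pmf p)" "\<And>x. x \<in> set_pmf p \<Longrightarrow> finite (set_pmf (g x))"
  shows "expect (bind_pmf p g) h = expect p (\<lambda>x. expect (g x) h)"
  using assms pmf_expectation_bind[of "set_pmf p" g p h]
    integral_measure_pmf[of "set_pmf p" p "\<lambda>x. expect (g x) h"] by simp

lemma expect_mono:
  assumes "finite (set_pmf p)" "\<And>x. x \<in> set_pmf p \<Longrightarrow> g x \<le> h x"
  shows "expect p g \<le> expect p h"
  using assms
  by (intro integral_mono_AE integrable_measure_pmf_finite) (auto simp: AE_measure_pmf_iff)

lemma expect_cong: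
  "(\<And>x. x \<in> set_pmf p \<Longrightarrow> g x = h x) \<Longrightarrow> expect p g = expect p h"
  by (intro integral_cong_AE) (auto simp: AE_measure_pmf_iff)

lemma expect_nonneg: "(\<And>x. x \<in> set_pmf p \<Longrightarrow> 0 \<le> h x) \<Longrightarrow> 0 \<le> expect p h"
  by (intro integral_nonneg_AE) (auto simp: AE_measure_pmf_iff)

lemma expect_add: "finite (set_pmf p) \<Longrightarrow> expect p (\<lambda>x. g x + h x) = expect p g + expect p h"
  and expect_diff: "finite (set_pmf p) \<Longrightarrow> expect p (\<lambda>x. g x - h x) = expect p g - expect p h"
  by (auto intro!: Bochner_Integration.integral_add Bochner_Integration.integral_diff
      integrable_measure_pmf_finite)

lemma expect_sum: "finite (set_pmf p) \<Longrightarrow> expect p (\<lambda>x. \<Sum>i\<in>I. g i x) = (\<Sum>i\<in>I. expect p (g i))"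
  by (intro Bochner_Integration.integral_sum integrable_measure_pmf_finite)

definition raises_mean :: "('b \<Rightarrow> real) \<Rightarrow> 'b \<Rightarrow> 'b pmf \<Rightarrow> bool" where
  "raises_mean \<phi> x D \<longleftrightarrow> finite (set_pmf D) \<and> \<phi> x \<le> expect D \<phi>"

lemma raises_mean_return [simp]: "raises_mean \<phi> x (return_pmf y) \<longleftrightarrow> \<phi> x \<le> \<phi> y"
  by (simp add: raises_mean_def)

lemma raises_mean_bind:
  assumes "raises_mean \<phi> x D" "\<And>y. y \<in> set_pmf D \<Longrightarrow> raises_mean \<phi> y (K y)"
  shows "raises_mean \<phi> x (bind_pmf D K)"
proof -
  have fin: "finite (set_pmf D)" "\<And>y. y \<in> set_pmf D \<Longrightarrow> finite (set_pmf (K y))"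
    using assms by (auto simp: raises_mean_def)
  have "\<phi> x \<le> expect D \<phi>" using assms(1) by (simp add: raises_mean_def)
  also have "\<dots> \<le> expect D (\<lambda>y. expect (K y) \<phi>)"
    using fin assms(2) by (intro expect_mono) (auto simp: raises_mean_def)
  also have "\<dots> = expect (bind_pmf D K) \<phi>" using fin by (simp add: expect_bind)
  finally show ?thesis using fin by (simp add: raises_mean_def)
qed

lemma raises_mean_iterate:
  assumes "\<And>x. I x \<Longrightarrow> raises_mean \<phi> x (outcome f (P x))"
    and "\<And>x y. I x \<Longrightarrow> y \<in> set_pmf (outcome f (P x)) \<Longrightarrow> I y" "I x"
  shows "raises_mean \<phi> x (outcome f (iterate n P x))"
  using assms(3) by (induction n arbitrary: x) (auto intro!: raises_mean_bind assms(1,2))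

section \<open>Submodular functions and random subsets\<close>

definition gain :: "('a set \<Rightarrow> real) \<Rightarrow> 'a set \<Rightarrow> 'a \<Rightarrow> real" where
  "gain f X v = f (insert v X) - f X"

abbreviation gain_pos :: "('a set \<Rightarrow> real) \<Rightarrow> 'a set \<Rightarrow> 'a \<Rightarrow> real" where
  "gain_pos f X v \<equiv> max 0 (gain f X v)"

lemma gain_mem: "v \<in> X \<Longrightarrow> gain f X v = 0"
  by (simp add: gain_def insert_absorb)

locale submodular_fun =
  fixes U :: "'a set" and f :: "'a set \<Rightarrow> real"
  assumes finite_ground: "finite U"
    and nonneg: "\<And>S. S \<subseteq> U \<Longrightarrow> 0 \<le> f S"
    and submodular: "submodular_on U f"
begin

lemma finite_sub: "X \<subseteq> U \<Longrightarrow> finite X"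
  using finite_ground finite_subset by blast

lemma gain_antimono:
  assumes "X \<subseteq> Y" "Y \<subseteq> U" "v \<in> U" "v \<notin> Y"
  shows "gain f Y v \<le> gain f X v"
proof -
  have "f (insert v X) + f Y \<ge> f (insert v X \<union> Y) + f (insert v X \<inter> Y)"
    by (rule submodular[unfolded submodular_on_def, rule_format]) (use assms in auto)
  moreover have "insert v X \<union> Y = insert v Y" "insert v X \<inter> Y = X"
    using assms by auto
  ultimately show ?thesis by (simp add: gain_def)
qed

lemma gain_pos_antimono:
  assumes "X \<subseteq> Y" "Y \<subseteq> U" "v \<in> U"
  shows "gain_pos f Y v \<le> gain_pos f X v"
  using gain_antimono[OF assms] gain_mem[of v Y f] by (cases "v \<in> Y") auto

lemma union_le_sum_gain_pos:
  assumes "Z \<subseteq> U" "X \<subseteq> U"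
  shows "f (Z \<union> X) - f X \<le> (\<Sum>z\<in>Z. gain_pos f X z)"
  using finite_sub[OF assms(1)] assms
proof (induction Z)
  case (insert z Z)
  have "f (insert z Z \<union> X) - f (Z \<union> X) = gain f (Z \<union> X) z" by (simp add: gain_def)
  also have "\<dots> \<le> gain_pos f (Z \<union> X) z" by simp
  also have "\<dots> \<le> gain_pos f X z" using insert by (intro gain_pos_antimono) auto
  finally show ?case using insert by simp
qed simp

lemma random_union_insert_ge:
  assumes fin: "finite (set_pmf p)" and sub: "S \<subseteq> U" "insert v W \<subseteq> U"
  shows "expect p (\<lambda>x. f (S \<union> (A x \<inter> W))) + expect p (\<lambda>x. of_bool (v \<in> A x)) * gain f (S \<union> W) v
    \<le> expect p (\<lambda>x. f (S \<union> (A x \<inter> insert v W)))"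
proof -
  have "f (S \<union> (A x \<inter> W)) + of_bool (v \<in> A x) * gain f (S \<union> W) v \<le> f (S \<union> (A x \<inter> insert v W))" for x
  proof (cases "v \<in> A x")
    case True
    have "gain f (S \<union> W) v \<le> gain f (S \<union> (A x \<inter> W)) v"
    proof (cases "v \<in> S \<union> W")
      case True
      then show ?thesis using \<open>v \<in> A x\<close> by (simp add: gain_mem)
    next
      case False
      then show ?thesis using sub by (intro gain_antimono) auto
    qed
    then show ?thesis using True by (simp add: gain_def)
  qed simp
  then have "expect p (\<lambda>x. f (S \<union> (A x \<inter> W)) + of_bool (v \<in> A x) * gain f (S \<union> W) v)
      \<le> expect p (\<lambda>x. f (S \<union> (A x \<inter> insert v W)))"
    by (intro expect_mono fin)
  then show ?thesis by (simp add: expect_add[OF fin])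
qed

text \<open>
  Elements are inserted by decreasing probability, so that the telescoping coefficient of each
  intermediate set is nonnegative.
\<close>

lemma random_union_Int_ge:
  fixes A :: "'b \<Rightarrow> 'a set" and p :: "'b pmf"
  defines "\<pi> v \<equiv> expect p (\<lambda>x. of_bool (v \<in> A x))"
  assumes fin: "finite (set_pmf p)" and S: "S \<subseteq> U" and prob: "\<And>v. v \<in> U \<Longrightarrow> \<pi> v \<le> \<rho>"
    and W: "W \<subseteq> U" and q: "q \<le> \<rho>" "\<And>v. v \<in> W \<Longrightarrow> q \<le> \<pi> v"
  shows "(1 - \<rho>) * f S + q * f (S \<union> W) \<le> expect p (\<lambda>x. f (S \<union> (A x \<inter> W)))"
  using finite_sub[OF W] W q
proof (induction W arbitrary: q rule: finite_ranking_induct[where f = "\<lambda>v. - \<pi> v"])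
  case empty
  have "q * f S \<le> \<rho> * f S" using empty nonneg[OF S] by (intro mult_right_mono)
  then show ?case by (simp add: algebra_simps)
next
  case (insert v W)
  have "q * f (S \<union> insert v W) \<le> \<pi> v * f (S \<union> insert v W)"
    using insert.prems S by (intro mult_right_mono nonneg) auto
  moreover have "(1 - \<rho>) * f S + \<pi> v * f (S \<union> W) \<le> expect p (\<lambda>x. f (S \<union> (A x \<inter> W)))"
    using insert prob by (intro insert.IH) auto
  moreover have "expect p (\<lambda>x. f (S \<union> (A x \<inter> W))) + \<pi> v * gain f (S \<union> W) v
      \<le> expect p (\<lambda>x. f (S \<union> (A x \<inter> insert v W)))"
    unfolding \<pi>_def using insert.prems by (intro random_union_insert_ge fin S) auto
  ultimately show ?case by (simp add: gain_def algebra_simps)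
qed

lemma random_union_ge:
  assumes fin: "finite (set_pmf p)" and S: "S \<subseteq> U" and sub: "\<And>x. x \<in> set_pmf p \<Longrightarrow> A x \<subseteq> U"
    and prob: "\<And>v. v \<in> U \<Longrightarrow> expect p (\<lambda>x. of_bool (v \<in> A x)) \<le> \<rho>" and "0 \<le> \<rho>"
  shows "(1 - \<rho>) * f S \<le> expect p (\<lambda>x. f (S \<union> A x))"
proof -
  have "(1 - \<rho>) * f S + 0 * f (S \<union> U) \<le> expect p (\<lambda>x. f (S \<union> (A x \<inter> U)))"
    using assms by (intro random_union_Int_ge) auto
  also have "\<dots> = expect p (\<lambda>x. f (S \<union> A x))"
    using sub by (intro expect_cong) (simp add: Int_absorb2)
  finally show ?thesis by simp
qed

end

section \<open>Random blocks\<close>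

definition enum_list :: "'a set \<Rightarrow> 'a list" where
  "enum_list A = (SOME xs. set xs = A \<and> distinct xs)"

lemma
  assumes "finite A"
  shows set_enum_list: "set (enum_list A) = A"
    and distinct_enum_list: "distinct (enum_list A)"
    and length_enum_list: "length (enum_list A) = card A"
proof -
  have "set (enum_list A) = A \<and> distinct (enum_list A)"
    unfolding enum_list_def by (rule someI_ex[OF finite_distinct_list[OF assms]])
  then show "set (enum_list A) = A" "distinct (enum_list A)" "length (enum_list A) = card A"
    using distinct_card[of "enum_list A"] by simp_all
qed

text \<open>Each element of \<open>B\<close> is picked with probability \<open>1 / l\<close>, whatever the size of \<open>B\<close>.\<close>

definition pick :: "nat \<Rightarrow> 'a set \<Rightarrow> 'a option pmf" where
  "pick l B = map_pmf (\<lambda>i. if i < card B then Some (enum_list B ! i) else None) (pmf_of_set {..<l})"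

lemma finite_pick: "0 < l \<Longrightarrow> finite (set_pmf (pick l B))"
  by (simp add: pick_def lessThan_empty_iff)

lemma set_option_pick:
  assumes "finite B" "0 < l" "x \<in> set_pmf (pick l B)"
  shows "set_option x \<subseteq> B"
proof -
  obtain i where "x = (if i < card B then Some (enum_list B ! i) else None)"
    using assms(3) unfolding pick_def set_map_pmf by blast
  then show ?thesis
    using set_enum_list[OF assms(1)] length_enum_list[OF assms(1)] nth_mem[of i "enum_list B"]
    by simp
qed

lemma expect_pick:
  assumes "finite B" "card B \<le> l" "0 < l"
  shows "expect (pick l B) h = ((\<Sum>b\<in>B. h (Some b)) + (real l - card B) * h None) / l"
proof -
  let ?xs = "enum_list B"
  have split: "{..<l} \<inter> {i. i < card B} = {..<card B}" "{..<l} \<inter> - {i. i < card B} = {card B..<l}"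
    using assms(2) by auto
  have "expect (pick l B) h = (\<Sum>i<l. if i < card B then h (Some (?xs ! i)) else h None) / l"
    unfolding pick_def using assms(3)
    by (simp add: integral_pmf_of_set lessThan_empty_iff if_distrib[of h])
  also have "(\<Sum>i<l. if i < card B then h (Some (?xs ! i)) else h None)
      = (\<Sum>i<card B. h (Some (?xs ! i))) + (real l - card B) * h None"
    using assms(2) by (simp add: sum.If_cases split of_nat_diff)
  also have "(\<Sum>i<card B. h (Some (?xs ! i))) = (\<Sum>b\<in>B. h (Some b))"
    using assms(1) by (intro sum.reindex_bij_betw bij_betw_nth)
      (simp_all add: set_enum_list distinct_enum_list length_enum_list)
  finally show ?thesis .
qed

definition block :: "nat \<Rightarrow> 'a set \<Rightarrow> 'a set pmf" where
  "block l V = pmf_of_set {B. B \<subseteq> V \<and> card B = min l (card V)}"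

lemma
  assumes "finite V"
  shows finite_blocks: "finite {B. B \<subseteq> V \<and> card B = b}"
    and blocks_nonempty: "{B. B \<subseteq> V \<and> card B = min l (card V)} \<noteq> {}"
    and set_block: "set_pmf (block l V) = {B. B \<subseteq> V \<and> card B = min l (card V)}"
proof -
  show fin: "finite {B. B \<subseteq> V \<and> card B = b}" for b
    by (rule finite_subset[of _ "Pow V"]) (use assms in auto)
  show ne: "{B. B \<subseteq> V \<and> card B = min l (card V)} \<noteq> {}"
    using obtain_subset_with_card_n[of "min l (card V)" V] by fastforce
  show "set_pmf (block l V) = {B. B \<subseteq> V \<and> card B = min l (card V)}"
    unfolding block_def by (intro set_pmf_of_set ne fin)
qed

lemma finite_block: "finite V \<Longrightarrow> finite (set_pmf (block l V))"
  by (simp add: set_block finite_blocks)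

lemma expect_block_mem:
  assumes "finite V" "v \<in> V"
  shows "expect (block l V) (\<lambda>B. of_bool (v \<in> B)) = min l (card V) / card V"
proof -
  define b m where "b = min l (card V)" and "m = card V"
  have bm: "b \<le> m" "0 < m" using assms by (auto simp: b_def m_def card_gt_0_iff)
  define F where "F = {B. B \<subseteq> V \<and> card B = b}"
  have F: "finite F" "card F = m choose b"
    unfolding F_def m_def using assms(1) by (auto intro: finite_blocks n_subsets)
  have "{B \<in> F. v \<notin> B} = {B. B \<subseteq> V - {v} \<and> card B = b}" by (auto simp: F_def)
  then have "card {B \<in> F. v \<notin> B} = (m - 1) choose b"
    using assms n_subsets[of "V - {v}" b] by (simp add: m_def)
  then have "m * card {B \<in> F. v \<notin> B} = (m - b) * card F"
    unfolding F(2) using binomial_absorb_comp[of m b] by simp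
  from arg_cong[OF this, of real] have "real m * card {B \<in> F. v \<notin> B} = (real m - b) * card F"
    by (simp only: of_nat_mult of_nat_diff[OF bm(1)])
  moreover have "card F = card {B \<in> F. v \<in> B} + card {B \<in> F. v \<notin> B}"
    using card_Int_Diff[OF F(1), of "{B. v \<in> B}"] by (simp add: Int_def set_diff_eq)
  ultimately have "card {B \<in> F. v \<in> B} * real m = b * real (card F)"
    by (simp add: algebra_simps)
  then have "card {B \<in> F. v \<in> B} / card F = b / m"
    using bm F(2) by (simp add: frac_eq_eq)
  moreover have "expect (block l V) (\<lambda>B. of_bool (v \<in> B)) = (\<Sum>B\<in>F. of_bool (v \<in> B)) / card F"
    unfolding block_def F_def b_def
    by (intro integral_pmf_of_set blocks_nonempty finite_blocks assms(1))
  moreover have "(\<Sum>B\<in>F. of_bool (v \<in> B)) = real (card {B \<in> F. v \<in> B})"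
    using F(1) by (simp add: of_bool_def sum.If_cases Int_def)
  ultimately show ?thesis by (simp add: b_def m_def)
qed

lemma expect_block_sum:
  assumes "finite V"
  shows "expect (block l V) (\<lambda>B. \<Sum>v\<in>B. h v) = min l (card V) / card V * (\<Sum>v\<in>V. h v)"
proof -
  have "expect (block l V) (\<lambda>B. \<Sum>v\<in>B. h v) = expect (block l V) (\<lambda>B. \<Sum>v\<in>V. of_bool (v \<in> B) * h v)"
  proof (rule expect_cong)
    fix B assume "B \<in> set_pmf (block l V)"
    then have "B \<subseteq> V" using assms by (simp add: set_block)
    then show "(\<Sum>v\<in>B. h v) = (\<Sum>v\<in>V. of_bool (v \<in> B) * h v)"
      using assms by (intro sum.mono_neutral_cong_left) auto
  qed
  also have "\<dots> = (\<Sum>v\<in>V. expect (block l V) (\<lambda>B. of_bool (v \<in> B)) * h v)"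
    by (subst expect_sum[OF finite_block[OF assms]]) simp
  also have "\<dots> = (\<Sum>v\<in>V. min l (card V) / card V * h v)"
    using assms by (intro sum.cong refl) (simp add: expect_block_mem)
  finally show ?thesis by (simp add: sum_distrib_left)
qed

definition draw :: "nat \<Rightarrow> 'a set \<Rightarrow> ('a set \<times> 'a option) pmf" where
  "draw l V = do { B \<leftarrow> block l V; map_pmf (Pair B) (pick l B) }"

definition valid_draw :: "nat \<Rightarrow> 'a set \<Rightarrow> 'a set \<times> 'a option \<Rightarrow> bool" where
  "valid_draw l V b \<longleftrightarrow> fst b \<subseteq> V \<and> card (fst b) = min l (card V) \<and> set_option (snd b) \<subseteq> fst b"

lemma
  assumes "0 < l" "finite V"
  shows draw_valid: "b \<in> set_pmf (draw l V) \<Longrightarrow> valid_draw l V b"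
    and finite_draw: "finite (set_pmf (draw l V))"
    and expect_draw: "expect (draw l V) h =
      expect (block l V) (\<lambda>B. ((\<Sum>b\<in>B. h (B, Some b)) + (real l - card B) * h (B, None)) / l)"
proof -
  have B: "finite B" "card B \<le> l" "B \<subseteq> V" "card B = min l (card V)" if "B \<in> set_pmf (block l V)" for B
    using that assms(2) by (auto simp: set_block intro: finite_subset)
  show "valid_draw l V b" if mem: "b \<in> set_pmf (draw l V)"
  proof -
    obtain B x where b: "b = (B, x)" "B \<in> set_pmf (block l V)" "x \<in> set_pmf (pick l B)"
      using mem by (auto simp: draw_def)
    then show ?thesis
      using B[OF b(2)] set_option_pick[OF _ assms(1) b(3)] by (simp add: valid_draw_def)
  qed
  show "finite (set_pmf (draw l V))"
    using assms by (simp add: draw_def finite_block finite_pick)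
  have "expect (draw l V) h = expect (block l V) (\<lambda>B. expect (pick l B) (\<lambda>x. h (B, x)))"
    unfolding draw_def using assms by (subst expect_bind) (auto simp: finite_block finite_pick)
  also have "\<dots> = expect (block l V)
      (\<lambda>B. ((\<Sum>b\<in>B. h (B, Some b)) + (real l - card B) * h (B, None)) / l)"
    by (intro expect_cong expect_pick B assms(1))
  finally show "expect (draw l V) h =
      expect (block l V) (\<lambda>B. ((\<Sum>b\<in>B. h (B, Some b)) + (real l - card B) * h (B, None)) / l)" .
qed

fun draws :: "nat \<Rightarrow> nat \<Rightarrow> 'a set \<Rightarrow> ('a set \<times> 'a option) list pmf" where
  "draws l 0 V = return_pmf []"
| "draws l (Suc n) V = (if V = {} then return_pmf [] else
     do { b \<leftarrow> draw l V; map_pmf ((#) b) (draws l n (V - fst b)) })"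

fun valid_draws :: "nat \<Rightarrow> nat \<Rightarrow> 'a set \<Rightarrow> ('a set \<times> 'a option) list \<Rightarrow> bool" where
  "valid_draws l n V [] \<longleftrightarrow> n = 0 \<or> V = {}"
| "valid_draws l n V (b # bs) \<longleftrightarrow>
     0 < n \<and> V \<noteq> {} \<and> valid_draw l V b \<and> valid_draws l (n - 1) (V - fst b) bs"

lemma finite_draws: "0 < l \<Longrightarrow> finite V \<Longrightarrow> finite (set_pmf (draws l n V))"
  by (induction n arbitrary: V) (auto simp: finite_draw)

lemma draws_valid: "0 < l \<Longrightarrow> finite V \<Longrightarrow> bs \<in> set_pmf (draws l n V) \<Longrightarrow> valid_draws l n V bs"
  by (induction n arbitrary: V bs) (auto simp: draw_valid split: if_splits)

lemma expect_draws_Suc: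
  assumes "0 < l" "finite V" "V \<noteq> {}"
  shows "expect (draws l (Suc n) V) h =
    expect (draw l V) (\<lambda>b. expect (draws l n (V - fst b)) (\<lambda>bs. h (b # bs)))"
  using assms by (simp add: expect_bind finite_draw finite_draws)

lemma length_valid_draws: "0 < l \<Longrightarrow> finite V \<Longrightarrow> valid_draws l n V bs \<Longrightarrow> length bs \<le> card V"
proof (induction bs arbitrary: n V)
  case (Cons b bs)
  then have b: "fst b \<subseteq> V" "card (fst b) = min l (card V)" "V \<noteq> {}" by (auto simp: valid_draw_def)
  have "length bs \<le> card (V - fst b)" using Cons.prems by (intro Cons.IH[of _ "n - 1"]) auto
  also have "\<dots> = card V - card (fst b)"
    using b Cons.prems(2) finite_subset by (intro card_Diff_subset) auto
  moreover have "0 < card V" using Cons.prems(2) b(3) by (simp add: card_gt_0_iff)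
  ultimately show ?case using b(2) Cons.prems(1) by simp
qed simp

section \<open>Geometric checkpoints\<close>

definition checkpoint :: "real \<Rightarrow> nat \<Rightarrow> bool" where
  "checkpoint \<delta> i \<longleftrightarrow> (\<exists>j::nat. i = nat \<lfloor>(1 + \<delta>) ^ j\<rfloor>)"

definition next_checkpoint :: "real \<Rightarrow> nat \<Rightarrow> nat" where
  "next_checkpoint \<delta> i = (LEAST c. i \<le> c \<and> checkpoint \<delta> c)"

context
  fixes \<delta> :: real
  assumes delta: "0 < \<delta>"
begin

lemma ex_checkpoint:
  assumes "1 \<le> c"
  obtains i where "checkpoint \<delta> i" "c \<le> i" "real i \<le> (1 + \<delta>) * c"
proof -
  define P where "P j \<longleftrightarrow> real c \<le> (1 + \<delta>) ^ j" for j :: nat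
  define j where "j = (LEAST j. P j)"
  have "\<exists>j. P j"
    unfolding P_def using real_arch_pow[of "1 + \<delta>" c] delta by (auto intro: less_imp_le)
  then have "P j" unfolding j_def by (rule LeastI_ex)
  have "(1 + \<delta>) ^ j \<le> (1 + \<delta>) * c"
  proof (cases j)
    case 0
    have "1 * 1 \<le> (1 + \<delta>) * c" using delta assms by (intro mult_mono) auto
    then show ?thesis using 0 by simp
  next
    case (Suc j')
    then have "\<not> P j'" unfolding j_def by (metis lessI not_less_Least)
    then show ?thesis using Suc delta by (simp add: P_def)
  qed
  moreover have "real (nat \<lfloor>(1 + \<delta>) ^ j\<rfloor>) \<le> (1 + \<delta>) ^ j" using delta by (intro of_nat_floor) simp
  ultimately have "real (nat \<lfloor>(1 + \<delta>) ^ j\<rfloor>) \<le> (1 + \<delta>) * c" by linarith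
  moreover have "c \<le> nat \<lfloor>(1 + \<delta>) ^ j\<rfloor>" using \<open>P j\<close> unfolding P_def by (rule le_nat_floor)
  ultimately show ?thesis by (intro that) (auto simp: checkpoint_def)
qed

lemma next_checkpoint_ge: "i \<le> next_checkpoint \<delta> i"
proof -
  obtain c where "max 1 i \<le> c" "checkpoint \<delta> c" using ex_checkpoint[of "max 1 i"] by auto
  then show ?thesis
    unfolding next_checkpoint_def using LeastI[of "\<lambda>c. i \<le> c \<and> checkpoint \<delta> c" c] by auto
qed

lemma next_checkpoint_le:
  assumes "1 \<le> i"
  shows "real (next_checkpoint \<delta> i) \<le> (1 + \<delta>) * i"
proof -
  obtain c where c: "checkpoint \<delta> c" "i \<le> c" "real c \<le> (1 + \<delta>) * i" using ex_checkpoint[OF assms] .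
  then have "next_checkpoint \<delta> i \<le> c" unfolding next_checkpoint_def by (intro Least_le) simp
  then show ?thesis using c(3) by linarith
qed

lemma next_checkpoint_Suc:
  assumes "\<not> checkpoint \<delta> i"
  shows "next_checkpoint \<delta> (Suc i) = next_checkpoint \<delta> i" "Suc i \<le> next_checkpoint \<delta> i"
proof -
  have "Suc i \<le> c \<and> checkpoint \<delta> c \<longleftrightarrow> i \<le> c \<and> checkpoint \<delta> c" for c
    using assms by (auto simp: Suc_le_eq order_less_le)
  then show "next_checkpoint \<delta> (Suc i) = next_checkpoint \<delta> i" by (simp add: next_checkpoint_def)
  then show "Suc i \<le> next_checkpoint \<delta> i" using next_checkpoint_ge[of "Suc i"] by simp
qed

lemma card_checkpoints_le:
  assumes "\<delta> \<le> 1"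
  shows "real (card {i. i \<le> n \<and> checkpoint \<delta> i}) \<le> 2 * ln (real n + 1) / \<delta> + 1"
proof -
  let ?J = "nat \<lfloor>2 * ln (real n + 1) / \<delta>\<rfloor>"
  have "j \<le> ?J" if j: "nat \<lfloor>(1 + \<delta>) ^ j\<rfloor> \<le> n" for j
  proof -
    have "(1 + \<delta>) ^ j < real n + 1" using j by linarith
    then have "ln ((1 + \<delta>) ^ j) < ln (real n + 1)" using delta by (subst ln_less_cancel_iff) auto
    then have "real j * ln (1 + \<delta>) < ln (real n + 1)" by (simp add: ln_realpow)
    moreover have "\<delta> / 2 \<le> ln (1 + \<delta>)"
    proof -
      have "\<delta> / 2 \<le> \<delta> / (1 + \<delta>)" using delta assms by (intro divide_left_mono) auto
      also have "\<dots> \<le> ln (1 + \<delta>)" using ln_add1_ge[of \<delta>] delta by (simp add: add.commute)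
      finally show ?thesis .
    qed
    then have "real j * (\<delta> / 2) \<le> real j * ln (1 + \<delta>)" by (intro mult_left_mono) auto
    ultimately have "real j \<le> 2 * ln (real n + 1) / \<delta>" using delta by (simp add: field_simps)
    then show ?thesis by (simp add: le_nat_floor)
  qed
  then have "{i. i \<le> n \<and> checkpoint \<delta> i} \<subseteq> (\<lambda>j. nat \<lfloor>(1 + \<delta>) ^ j\<rfloor>) ` {..?J}"
    by (auto simp: checkpoint_def)
  then have "card {i. i \<le> n \<and> checkpoint \<delta> i} \<le> card {..?J}"
    by (meson card_image_le card_mono finite_atMost finite_imageI le_trans)
  then have "real (card {i. i \<le> n \<and> checkpoint \<delta> i}) \<le> real ?J + 1" by simp
  moreover have "real ?J \<le> 2 * ln (real n + 1) / \<delta>" using delta by (intro of_nat_floor) auto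
  ultimately show ?thesis by linarith
qed

end

section \<open>Threshold sampling\<close>

text \<open>
  An accepted element may have a very negative gain. All accepted elements enter \<open>taken\<close>, relative
  to which gains are measured, but only those with nonnegative gain enter \<open>kept\<close>, the output.
  The field \<open>price\<close> does not influence the run: it records the threshold at which each element of
  \<open>seen\<close> was considered.
\<close>

record 'a sampler =
  taken :: "'a set"
  kept :: "'a set"
  seen :: "'a set"
  cand :: "'a set"
  budget :: nat
  threshold :: real
  price :: "'a \<Rightarrow> real"

definition absorb :: "('a set \<Rightarrow> real) \<Rightarrow> 'a set \<times> 'a option \<Rightarrow> 'a sampler \<Rightarrow> 'a sampler" where
  "absorb f b st = st\<lparr>taken := taken st \<union> set_option (snd b),
     kept := kept st \<union> {a \<in> set_option (snd b). 0 \<le> gain f (taken st) a},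
     seen := seen st \<union> fst b, cand := cand st - fst b, budget := budget st - 1,
     price := (\<lambda>v. if v \<in> fst b then threshold st else price st v)\<rparr>"

lemma absorb_simps [simp]:
  "taken (absorb f b st) = taken st \<union> set_option (snd b)"
  "kept (absorb f b st) = kept st \<union> {a \<in> set_option (snd b). 0 \<le> gain f (taken st) a}"
  "seen (absorb f b st) = seen st \<union> fst b"
  "cand (absorb f b st) = cand st - fst b"
  "budget (absorb f b st) = budget st - 1"
  "threshold (absorb f b st) = threshold st"
  "price (absorb f b st) = (\<lambda>v. if v \<in> fst b then threshold st else price st v)"
  by (simp_all add: absorb_def)

definition prune :: "('a set \<Rightarrow> real) \<Rightarrow> 'a sampler \<Rightarrow> 'a sampler" where
  "prune f st = st\<lparr>cand := {v \<in> cand st. threshold st \<le> gain f (taken st) v}\<rparr>"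

lemma prune_simps [simp]:
  "taken (prune f st) = taken st" "kept (prune f st) = kept st" "seen (prune f st) = seen st"
  "cand (prune f st) = {v \<in> cand st. threshold st \<le> gain f (taken st) v}"
  "budget (prune f st) = budget st" "threshold (prune f st) = threshold st"
  "price (prune f st) = price st"
  by (simp_all add: prune_def)

definition neighbours :: "'a set \<Rightarrow> 'a set \<Rightarrow> 'a set list" where
  "neighbours V X = X # map (\<lambda>v. insert v X) (enum_list V)"

lemma length_neighbours: "finite V \<Longrightarrow> length (neighbours V X) = card V + 1"
  by (simp add: neighbours_def length_enum_list)

lemma set_neighbours: "finite V \<Longrightarrow> set (neighbours V X) = insert X ((\<lambda>v. insert v X) ` V)"
  by (simp add: neighbours_def set_enum_list)

lemma gain_cong:
  assumes "\<And>S. S \<in> set (neighbours V X) \<Longrightarrow> g S = f S" "finite V" "v \<in> V"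
  shows "gain g X v = gain f X v"
  using assms by (simp add: gain_def set_neighbours)

lemma
  assumes U: "finite U" "X \<subseteq> U" and k: "\<And>g. (\<And>v. v \<in> U \<Longrightarrow> gain g X v = gain f X v) \<Longrightarrow> k g = k f"
  shows outcome_neighbours_query: "outcome f (query U (neighbours U X) \<bind> k) = outcome f (k f)"
    and cost_le_neighbours_query: "cost_le f (k f) R Q \<Longrightarrow>
      cost_le f (query U (neighbours U X) \<bind> k) (1 + R) (real (card U + 1) + Q)"
proof -
  have sub: "S \<subseteq> U" if "S \<in> set (neighbours U X)" for S
    using that U by (auto simp: set_neighbours)
  have k': "k g = k f" if "\<And>S. S \<in> set (neighbours U X) \<Longrightarrow> g S = f S" for g
    using gain_cong[OF that U(1)] by (rule k)
  show "outcome f (query U (neighbours U X) \<bind> k) = outcome f (k f)"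
    using sub k' by (rule outcome_query_bind)
  show "cost_le f (query U (neighbours U X) \<bind> k) (1 + R) (real (card U + 1) + Q)"
    if "cost_le f (k f) R Q"
    using cost_le_query_bind[where Qs = "neighbours U X" and k = k, OF sub k' that]
    by (simp add: length_neighbours U(1))
qed

locale threshold_sampler =
  fixes U :: "'a set" and \<delta> :: real and l m T L :: nat
begin

definition plenty :: "('a set \<Rightarrow> real) \<Rightarrow> nat \<Rightarrow> 'a sampler \<Rightarrow> bool" where
  "plenty f N st \<longleftrightarrow> (1 - \<delta>) * real N < real (card (cand (prune f st)))"

definition halts :: "('a set \<Rightarrow> real) \<Rightarrow> nat \<Rightarrow> nat \<Rightarrow> 'a sampler \<Rightarrow> bool" where
  "halts f N i st \<longleftrightarrow> checkpoint \<delta> i \<and> \<not> plenty f N st"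

primrec walk ::
  "('a set \<Rightarrow> real) \<Rightarrow> nat \<Rightarrow> nat \<Rightarrow> 'a sampler \<Rightarrow> ('a set \<times> 'a option) list \<Rightarrow> 'a sampler" where
  "walk f N i st [] = prune f st"
| "walk f N i st (b # bs) =
     (if halts f N i st then prune f st else walk f N (Suc i) (absorb f b st) bs)"

primrec walk_queries :: "'a set \<Rightarrow> nat \<Rightarrow> 'a set \<Rightarrow> ('a set \<times> 'a option) list \<Rightarrow> 'a set list" where
  "walk_queries V i X [] = neighbours V X"
| "walk_queries V i X (b # bs) =
     (if checkpoint \<delta> i then neighbours V X else [X]) @
     walk_queries V (Suc i) (X \<union> set_option (snd b)) bs"

definition batch :: "'a sampler \<Rightarrow> ('a, 'a sampler) program" where
  "batch st = (if cand st = {} \<or> budget st = 0 then Done st else do {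
     bs \<leftarrow> sample (draws l (budget st) (cand st));
     g \<leftarrow> query U (walk_queries (cand st) 0 (taken st) bs);
     Done (walk g (card (cand st)) 0 st bs)
   })"

definition refill :: "('a set \<Rightarrow> real) \<Rightarrow> 'a sampler \<Rightarrow> 'a sampler" where
  "refill f st = st\<lparr>cand := {v \<in> U - seen st. threshold st \<le> gain f (taken st) v}\<rparr>"

definition lower :: "'a sampler \<Rightarrow> 'a sampler" where
  "lower st = (if budget st = 0 then st else st\<lparr>threshold := (1 - \<delta>) * threshold st\<rparr>)"

definition level_given :: "('a set \<Rightarrow> real) \<Rightarrow> 'a sampler \<Rightarrow> ('a, 'a sampler) program" where
  "level_given g st = do { st' \<leftarrow> iterate T batch (refill g st); Done (lower st') }"

definition level :: "'a sampler \<Rightarrow> ('a, 'a sampler) program" where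
  "level st = (if budget st = 0 then Done st
     else query U (neighbours U (taken st)) \<bind> (\<lambda>g. level_given g st))"

definition top_gain :: "('a set \<Rightarrow> real) \<Rightarrow> 'a set \<Rightarrow> real" where
  "top_gain f G = Max (gain f G ` U)"

definition start :: "real \<Rightarrow> 'a set \<Rightarrow> 'a sampler" where
  "start W G = \<lparr>taken = G, kept = G, seen = {}, cand = {}, budget = m, threshold = W,
     price = (\<lambda>_. 0)\<rparr>"

definition stage_given :: "('a set \<Rightarrow> real) \<Rightarrow> 'a set \<Rightarrow> ('a, 'a set) program" where
  "stage_given g G = (if top_gain g G \<le> 0 then Done G else do {
     st \<leftarrow> iterate L level (start (top_gain g G) G);
     Done (kept st)
   })"

definition stage :: "'a set \<Rightarrow> ('a, 'a set) program" where
  "stage G = query U (neighbours U G) \<bind> (\<lambda>g. stage_given g G)"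

lemma refill_simps [simp]:
  "taken (refill f st) = taken st" "kept (refill f st) = kept st" "seen (refill f st) = seen st"
  "cand (refill f st) = {v \<in> U - seen st. threshold st \<le> gain f (taken st) v}"
  "budget (refill f st) = budget st" "threshold (refill f st) = threshold st"
  "price (refill f st) = price st"
  by (simp_all add: refill_def)

lemma level_given_cong:
  "(\<And>v. v \<in> U \<Longrightarrow> gain g (taken st) v = gain f (taken st) v) \<Longrightarrow> level_given g st = level_given f st"
  by (simp add: level_given_def refill_def cong: conj_cong)

lemma stage_given_cong:
  "(\<And>v. v \<in> U \<Longrightarrow> gain g G v = gain f G v) \<Longrightarrow> stage_given g G = stage_given f G"
  by (simp add: stage_given_def top_gain_def cong: image_cong)

lemma lower_simps [simp]:
  "taken (lower st) = taken st" "kept (lower st) = kept st" "seen (lower st) = seen st"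
  "budget (lower st) = budget st" "price (lower st) = price st"
  by (simp_all add: lower_def)

lemma legal_batch: "legal U (batch st)"
  by (simp add: batch_def legal_bind legal_sample legal_query)

lemma legal_level: "legal U (level st)"
  by (simp add: level_def level_given_def legal_bind legal_query legal_iterate legal_batch)

lemma legal_stage: "legal U (stage G)"
  by (simp add: stage_def stage_given_def legal_bind legal_query legal_iterate legal_level)

lemma set_walk_queries_init: "X \<in> set (walk_queries V i X bs)"
  by (cases bs) (auto simp: neighbours_def)

lemma prune_cong:
  assumes "\<And>S. S \<in> set (neighbours V (taken st)) \<Longrightarrow> g S = f S" "finite V" "cand st \<subseteq> V"
  shows "prune g st = prune f st"
proof -
  have "gain g (taken st) v = gain f (taken st) v" if "v \<in> cand st" for v
    using assms that by (intro gain_cong[of V]) auto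
  then show ?thesis by (auto simp: prune_def intro!: arg_cong[of _ _ "\<lambda>V. st\<lparr>cand := V\<rparr>"])
qed

lemma absorb_cong:
  assumes "g (taken st) = f (taken st)"
    and "g (taken st \<union> set_option (snd b)) = f (taken st \<union> set_option (snd b))"
  shows "absorb g b st = absorb f b st"
proof -
  have "{a \<in> set_option (snd b). 0 \<le> gain g (taken st) a}
      = {a \<in> set_option (snd b). 0 \<le> gain f (taken st) a}"
    using assms by (cases "snd b") (auto simp: gain_def)
  then show ?thesis by (simp add: absorb_def)
qed

lemma walk_cong:
  assumes "\<And>S. S \<in> set (walk_queries V i (taken st) bs) \<Longrightarrow> g S = f S" "finite V" "cand st \<subseteq> V"
  shows "walk g N i st bs = walk f N i st bs"
  using assms
proof (induction bs arbitrary: i st)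
  case Nil
  then show ?case by (auto intro: prune_cong)
next
  case (Cons b bs)
  have "g (taken st) = f (taken st)"
    using Cons.prems(1) set_walk_queries_init by blast
  moreover have "g (taken st \<union> set_option (snd b)) = f (taken st \<union> set_option (snd b))"
    using Cons.prems(1) set_walk_queries_init by auto
  ultimately have "absorb g b st = absorb f b st" by (rule absorb_cong)
  moreover have "walk g N (Suc i) (absorb f b st) bs = walk f N (Suc i) (absorb f b st) bs"
    using Cons.prems by (intro Cons.IH) auto
  moreover have "prune g st = prune f st" if "checkpoint \<delta> i"
    using Cons.prems that by (intro prune_cong[of V]) auto
  ultimately show ?case by (auto simp: halts_def plenty_def simp del: prune_simps)
qed

lemma length_walk_queries:
  assumes "finite V"
  shows "length (walk_queries V i X bs) =
    length bs + 1 + card V * (1 + card {j \<in> {i..<i + length bs}. checkpoint \<delta> j})"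
proof (induction bs arbitrary: i X)
  case Nil
  then show ?case by (simp add: length_neighbours assms)
next
  case (Cons b bs)
  have "{j \<in> {i..<i + length (b # bs)}. checkpoint \<delta> j} =
      (if checkpoint \<delta> i then {i} else {}) \<union> {j \<in> {Suc i..<Suc i + length bs}. checkpoint \<delta> j}"
    by (auto simp: le_eq_less_or_eq)
  then have "card {j \<in> {i..<i + length (b # bs)}. checkpoint \<delta> j} =
      of_bool (checkpoint \<delta> i) + card {j \<in> {Suc i..<Suc i + length bs}. checkpoint \<delta> j}"
    by simp
  then show ?case using Cons by (simp add: length_neighbours assms)
qed

lemma walk_queries_subset:
  assumes "valid_draws l n V bs" "finite W" "V \<subseteq> U" "W \<subseteq> U" "X \<subseteq> U" "S \<in> set (walk_queries W i X bs)"
  shows "S \<subseteq> U"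
  using assms
proof (induction bs arbitrary: n V X i)
  case Nil
  then show ?case by (auto simp: set_neighbours)
next
  case (Cons b bs)
  then have b: "fst b \<subseteq> V" "set_option (snd b) \<subseteq> fst b" by (auto simp: valid_draw_def)
  show ?case
  proof (cases "S \<in> set (walk_queries W (Suc i) (X \<union> set_option (snd b)) bs)")
    case True
    show ?thesis
      by (rule Cons.IH[OF _ _ _ _ _ True, of "n - 1" "V - fst b"]) (use Cons.prems b in auto)
  next
    case False
    then show ?thesis using Cons.prems b by (auto simp: set_neighbours split: if_splits)
  qed
qed

lemma walk_induct [consumes 2, case_names absorb]:
  assumes "valid_draws l (budget st) (cand st) bs" "I st"
    and "\<And>st b. I st \<Longrightarrow> 0 < budget st \<Longrightarrow> cand st \<noteq> {} \<Longrightarrow> valid_draw l (cand st) b \<Longrightarrow> I (absorb f b st)"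
  obtains st' where "I st'" "walk f N i st bs = prune f st'"
    "budget st' = 0 \<or> cand st' = {} \<or> \<not> plenty f N st'"
  using assms(1,2)
proof (induction bs arbitrary: i st thesis)
  case Nil
  then show ?case by auto
next
  case (Cons b bs)
  show ?case
  proof (cases "halts f N i st")
    case True
    then show ?thesis using Cons.prems by (auto simp: halts_def)
  next
    case False
    moreover have "I (absorb f b st)" using Cons.prems by (intro assms(3)) auto
    ultimately show ?thesis
      using Cons.prems Cons.IH[of "Suc i" "absorb f b st"] by auto
  qed
qed

end

locale threshold_sampling = submodular_fun U f + threshold_sampler U \<delta> l m T L
  for U :: "'a set" and f :: "'a set \<Rightarrow> real" and \<delta> :: real and l m T L :: nat +
  assumes delta: "0 < \<delta>" "\<delta> < 1" and l_pos: "0 < l"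
begin

subsection \<open>Invariants\<close>

definition credit :: "'a sampler \<Rightarrow> real" where
  "credit st = (\<Sum>v\<in>seen st. price st v)"

definition sound :: "'a set \<Rightarrow> 'a sampler \<Rightarrow> bool" where
  "sound G st \<longleftrightarrow> G \<subseteq> kept st \<and> kept st \<subseteq> taken st \<and> taken st \<subseteq> U \<and> f (taken st) \<le> f (kept st) \<and>
     card (kept st) + budget st \<le> card G + m"

definition priced :: "'a sampler \<Rightarrow> bool" where
  "priced st \<longleftrightarrow> seen st \<subseteq> U \<and> 0 < threshold st \<and>
     (\<forall>v\<in>seen st. (1 - \<delta>) * gain_pos f (taken st) v \<le> price st v \<and> threshold st \<le> price st v) \<and>
     (\<forall>v\<in>U - seen st. (1 - \<delta>) * gain_pos f (taken st) v \<le> threshold st)"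

definition charged :: "'a set \<Rightarrow> real \<Rightarrow> 'a sampler \<Rightarrow> bool" where
  "charged G W st \<longleftrightarrow> W \<le> credit st \<or>
     taken st = G \<and> seen st = {} \<and> threshold st = W \<and> budget st = m"

definition sampling :: "'a sampler \<Rightarrow> bool" where
  "sampling st \<longleftrightarrow> cand st \<subseteq> U - seen st \<and> cand st \<inter> taken st = {} \<and>
     (\<forall>v\<in>U - seen st - cand st. gain f (taken st) v < threshold st)"

text \<open>
  A stage is to consider \<open>l * m\<close> elements. Every block has \<open>l\<close> elements, except that the last block of
  each of the \<open>i\<close> levels so far may be smaller.
\<close>

definition level_inv :: "'a set \<Rightarrow> real \<Rightarrow> nat \<Rightarrow> 'a sampler \<Rightarrow> bool" where
  "level_inv G W i st \<longleftrightarrow> sound G st \<and> priced st \<and> charged G W st \<and>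
     (budget st = 0 \<or> threshold st = (1 - \<delta>) ^ i * W) \<and>
     l * m \<le> card (seen st) + l * (budget st + i)"

definition walk_inv :: "'a set \<Rightarrow> real \<Rightarrow> nat \<Rightarrow> 'a sampler \<Rightarrow> bool" where
  "walk_inv G W i st \<longleftrightarrow> sound G st \<and> priced st \<and> charged G W st \<and> sampling st \<and>
     threshold st = (1 - \<delta>) ^ i * W \<and>
     l * m \<le> card (seen st) + l * (budget st + i + of_bool (cand st = {}))"

lemma credit_cong: "seen st' = seen st \<Longrightarrow> price st' = price st \<Longrightarrow> credit st' = credit st"
  by (simp add: credit_def)

lemma finite_cand: "sampling st \<Longrightarrow> finite (cand st)"
  unfolding sampling_def by (rule finite_sub) auto

context
  fixes st :: "'a sampler" and b :: "'a set \<times> 'a option"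
  assumes priced: "priced st" and sampling: "sampling st" and b: "valid_draw l (cand st) b"
begin

lemma
  shows finite_drawn: "finite (fst b)" and drawn_disjoint: "seen st \<inter> fst b = {}"
    and drawn_sub: "fst b \<subseteq> U" "set_option (snd b) \<subseteq> U"
  using b sampling unfolding valid_draw_def sampling_def by (auto intro!: finite_sub)

lemma credit_absorb: "credit (absorb f b st) = credit st + threshold st * card (fst b)"
proof -
  have "finite (seen st)" using priced by (auto simp: priced_def intro: finite_sub)
  then have "credit (absorb f b st)
      = (\<Sum>v\<in>seen st. if v \<in> fst b then threshold st else price st v) + (\<Sum>v\<in>fst b. threshold st)"
    using finite_drawn drawn_disjoint unfolding credit_def by (simp add: sum.union_disjoint)
  also have "(\<Sum>v\<in>seen st. if v \<in> fst b then threshold st else price st v) = credit st"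
    unfolding credit_def using drawn_disjoint by (intro sum.cong) auto
  finally show ?thesis by (simp add: mult.commute)
qed

context
  fixes G :: "'a set"
  assumes sound: "sound G st"
begin

lemma gain_pos_absorb:
  assumes "v \<in> U"
  shows "gain_pos f (taken (absorb f b st)) v \<le> gain_pos f (taken st) v"
  using sound drawn_sub assms by (intro gain_pos_antimono) (auto simp: sound_def)

lemma kept_absorb:
  assumes x: "snd b = Some a"
  shows "f (kept st) + gain_pos f (taken st) a \<le> f (kept (absorb f b st))"
    and "f (taken (absorb f b st)) - f (taken st) \<le> f (kept (absorb f b st)) - f (kept st)"
proof -
  have "a \<notin> taken st" "a \<in> U"
    using x b sampling by (auto simp: valid_draw_def sampling_def)
  then have "gain f (taken st) a \<le> gain f (kept st) a"
    using sound unfolding sound_def by (intro gain_antimono) auto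
  moreover have "kept (absorb f b st) =
      (if 0 \<le> gain f (taken st) a then insert a (kept st) else kept st)"
    using x by auto
  ultimately show le: "f (kept st) + gain_pos f (taken st) a \<le> f (kept (absorb f b st))"
    by (auto simp: gain_def)
  then show "f (taken (absorb f b st)) - f (taken st) \<le> f (kept (absorb f b st)) - f (kept st)"
    using x by (simp add: gain_def)
qed

lemma sound_absorb:
  assumes budget: "0 < budget st"
  shows "sound G (absorb f b st)"
proof -
  have "f (taken (absorb f b st)) \<le> f (kept (absorb f b st))"
  proof (cases "snd b")
    case (Some a)
    then show ?thesis using kept_absorb(2)[OF Some] sound by (simp add: sound_def)
  qed (use sound in \<open>simp add: sound_def\<close>)
  moreover have "card (kept (absorb f b st)) \<le> card (kept st) + 1"
  proof -
    have "card {a \<in> set_option (snd b). 0 \<le> gain f (taken st) a} \<le> card (set_option (snd b))"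
      by (intro card_mono) auto
    also have "\<dots> \<le> 1" by (cases "snd b") auto
    finally show ?thesis
      using card_Un_le[of "kept st" "{a \<in> set_option (snd b). 0 \<le> gain f (taken st) a}"] by simp
  qed
  ultimately show ?thesis using sound drawn_sub budget unfolding sound_def by auto
qed

lemma priced_absorb: "priced (absorb f b st)"
proof -
  have bound: "(1 - \<delta>) * gain_pos f (taken (absorb f b st)) v \<le> c"
    if "v \<in> U" "(1 - \<delta>) * gain_pos f (taken st) v \<le> c" for v c
  proof (rule order_trans[OF mult_left_mono that(2)])
    show "gain_pos f (taken (absorb f b st)) v \<le> gain_pos f (taken st) v"
      using that(1) by (rule gain_pos_absorb)
  qed (use delta in simp)
  show ?thesis
    unfolding priced_def
  proof (intro conjI ballI)
    fix v assume v: "v \<in> seen (absorb f b st)"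
    show "threshold (absorb f b st) \<le> price (absorb f b st) v"
      using v priced by (auto simp: priced_def)
    show "(1 - \<delta>) * gain_pos f (taken (absorb f b st)) v \<le> price (absorb f b st) v"
      using v priced drawn_sub drawn_disjoint by (intro bound) (auto simp: priced_def)
  next
    fix v assume "v \<in> U - seen (absorb f b st)"
    then show "(1 - \<delta>) * gain_pos f (taken (absorb f b st)) v \<le> threshold (absorb f b st)"
      using priced by (intro bound) (auto simp: priced_def)
  qed (use priced drawn_sub in \<open>auto simp: priced_def\<close>)
qed

lemma sampling_absorb: "sampling (absorb f b st)"
proof -
  have "gain f (taken (absorb f b st)) v < threshold st"
    if v: "v \<in> U - seen (absorb f b st) - cand (absorb f b st)" for v
  proof -
    have "gain f (taken (absorb f b st)) v \<le> gain_pos f (taken (absorb f b st)) v" by simp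
    also have "\<dots> \<le> gain_pos f (taken st) v" using v by (intro gain_pos_absorb) auto
    also have "\<dots> < threshold st" using v priced sampling by (auto simp: sampling_def priced_def)
    finally show ?thesis .
  qed
  then show ?thesis using sampling b unfolding sampling_def valid_draw_def by auto
qed

lemma walk_inv_absorb:
  assumes inv: "walk_inv G W i st" and budget: "0 < budget st" and cand: "cand st \<noteq> {}"
  shows "walk_inv G W i (absorb f b st)"
proof -
  note fin = finite_cand[OF sampling]
  have "1 \<le> card (fst b)"
    using b fin cand l_pos by (simp add: valid_draw_def Suc_le_eq card_gt_0_iff)
  moreover have thr: "0 < threshold st" using priced by (simp add: priced_def)
  ultimately have "threshold st \<le> threshold st * card (fst b)" by simp
  moreover have "0 \<le> credit st"
    unfolding credit_def using priced thr by (intro sum_nonneg) (force simp: priced_def)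
  moreover have "W \<le> credit st \<or> W \<le> threshold st"
    using inv by (auto simp: walk_inv_def charged_def)
  ultimately have "W \<le> credit (absorb f b st)" using thr unfolding credit_absorb by linarith
  then have "charged G W (absorb f b st)" by (simp add: charged_def)
  moreover have "l * m \<le> card (seen (absorb f b st)) +
      l * (budget (absorb f b st) + i + of_bool (cand (absorb f b st) = {}))"
  proof -
    have "finite (seen st)" using priced by (auto simp: priced_def intro: finite_sub)
    then have "card (seen (absorb f b st)) = card (seen st) + card (fst b)"
      using finite_drawn drawn_disjoint by (simp add: card_Un_disjoint)
    moreover have "l * m \<le> card (seen st) + l * (budget (absorb f b st) + i) + l"
      using inv cand budget by (cases "budget st") (auto simp: walk_inv_def algebra_simps)
    moreover have "card (fst b) = l \<or> cand (absorb f b st) = {}"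
      using b card_subset_eq[OF fin, of "fst b"]
      by (auto simp: valid_draw_def min_def split: if_splits)
    ultimately show ?thesis by (auto simp: algebra_simps)
  qed
  ultimately show ?thesis
    using inv sound_absorb[OF budget] priced_absorb sampling_absorb by (simp add: walk_inv_def)
qed

end

end

definition batch_inv :: "'a set \<Rightarrow> real \<Rightarrow> nat \<Rightarrow> 'a sampler \<Rightarrow> bool" where
  "batch_inv G W i st \<longleftrightarrow> walk_inv G W i st \<and> prune f st = st"

lemma batch_inv_prune:
  assumes "walk_inv G W i st"
  shows "batch_inv G W i (prune f st)"
proof -
  have "credit (prune f st) = credit st" by (rule credit_cong) simp_all
  moreover have "of_bool (cand st = {}) \<le> (of_bool (cand (prune f st) = {}) :: nat)" by auto
  then have "l * m \<le> card (seen st) + l * (budget st + i + of_bool (cand (prune f st) = {}))"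
    using assms unfolding walk_inv_def by (meson add_left_mono mult_left_mono le0 le_trans)
  moreover have "prune f (prune f st) = prune f st" by (simp add: prune_def)
  ultimately show ?thesis
    using assms
    by (auto simp: batch_inv_def walk_inv_def sound_def priced_def charged_def sampling_def)
qed

lemma
  assumes inv: "walk_inv G W i st" and bs: "valid_draws l (budget st) (cand st) bs"
  defines "st' \<equiv> walk f (card (cand st)) 0 st bs"
  shows batch_inv_walk: "batch_inv G W i st'"
    and card_cand_walk_le: "budget st' = 0 \<or> real (card (cand st')) \<le> (1 - \<delta>) * card (cand st)"
proof -
  have step: "walk_inv G W i (absorb f b s)"
    if "walk_inv G W i s" "0 < budget s" "cand s \<noteq> {}" "valid_draw l (cand s) b" for s b
    using that by (intro walk_inv_absorb) (auto simp: walk_inv_def)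
  obtain s where s: "walk_inv G W i s" "st' = prune f s"
    "budget s = 0 \<or> cand s = {} \<or> \<not> plenty f (card (cand st)) s"
    unfolding st'_def using walk_induct[OF bs, of "walk_inv G W i", OF inv step] by blast
  show "batch_inv G W i st'" using s batch_inv_prune by simp
  show "budget st' = 0 \<or> real (card (cand st')) \<le> (1 - \<delta>) * card (cand st)"
    using s(3) delta unfolding s(2) plenty_def
    by (auto simp del: prune_simps(4)) (simp add: prune_def)
qed

definition query_rate :: real where
  "query_rate = 4 + 2 * ln (real (card U) + 1) / \<delta>"

lemma query_rate_nonneg: "0 \<le> query_rate"
  using delta by (simp add: query_rate_def)

context
  fixes st :: "'a sampler"
  assumes sampling: "sampling st" and taken: "taken st \<subseteq> U"
    and active: "cand st \<noteq> {}" "budget st \<noteq> 0"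
begin

lemma walk_queries_sound:
  assumes bs: "bs \<in> set_pmf (draws l (budget st) (cand st))"
  shows "S \<in> set (walk_queries (cand st) 0 (taken st) bs) \<Longrightarrow> S \<subseteq> U"
    and "(\<And>S. S \<in> set (walk_queries (cand st) 0 (taken st) bs) \<Longrightarrow> g S = f S) \<Longrightarrow>
      walk g N 0 st bs = walk f N 0 st bs"
proof -
  note fin = finite_cand[OF sampling]
  have "cand st \<subseteq> U" using sampling by (auto simp: sampling_def)
  then show "S \<subseteq> U" if "S \<in> set (walk_queries (cand st) 0 (taken st) bs)"
    using walk_queries_subset[OF draws_valid[OF l_pos fin bs] fin _ _ taken that] by simp
  show "walk g N 0 st bs = walk f N 0 st bs"
    if "\<And>S. S \<in> set (walk_queries (cand st) 0 (taken st) bs) \<Longrightarrow> g S = f S"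
    using walk_cong[OF that fin] by simp
qed

lemma length_walk_queries_le:
  assumes bs: "bs \<in> set_pmf (draws l (budget st) (cand st))"
  shows "length (walk_queries (cand st) 0 (taken st) bs) \<le> query_rate * card (cand st)"
proof -
  note fin = finite_cand[OF sampling]
  let ?c = "real (card (cand st))"
  let ?n = "card {j \<in> {0..<0 + length bs}. checkpoint \<delta> j}"
  have cand: "1 \<le> card (cand st)" "card (cand st) \<le> card U"
    using active fin finite_ground sampling
    by (auto simp: Suc_le_eq card_gt_0_iff sampling_def intro!: card_mono)
  have bs_le: "length bs \<le> card (cand st)"
    by (rule length_valid_draws[OF l_pos fin draws_valid[OF l_pos fin bs]])
  then have "?n \<le> card {j. j \<le> card U \<and> checkpoint \<delta> j}" using cand by (intro card_mono) auto
  then have "1 + real ?n \<le> query_rate - 2"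
    using card_checkpoints_le[OF delta(1), of "card U"] delta by (simp add: query_rate_def)
  then have "?c * (1 + real ?n) \<le> ?c * (query_rate - 2)" by (intro mult_left_mono) auto
  moreover have "length bs + 1 \<le> 2 * card (cand st)" using bs_le cand(1) by linarith
  then have "real (length bs + 1) \<le> 2 * ?c" by linarith
  moreover have "real (length (walk_queries (cand st) 0 (taken st) bs))
      = real (length bs + 1) + ?c * (1 + real ?n)"
    unfolding length_walk_queries[OF fin] by (simp add: distrib_left)
  ultimately show ?thesis by (simp add: algebra_simps)
qed

lemma
  assumes bs: "bs \<in> set_pmf (draws l (budget st) (cand st))"
  defines "Qs \<equiv> walk_queries (cand st) 0 (taken st) bs"
  shows outcome_walk: "outcome f (query U Qs \<bind> (\<lambda>g. Done (walk g N 0 st bs)))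
      = return_pmf (walk f N 0 st bs)"
    and cost_le_walk: "cost_le f (query U Qs \<bind> (\<lambda>g. Done (walk g N 0 st bs))) 1
      (query_rate * card (cand st))"
proof -
  let ?k = "\<lambda>g. Done (walk g N 0 st bs)"
  note Qs = walk_queries_sound(1)[OF bs, folded Qs_def]
  have k: "?k g = ?k f" if "\<And>S. S \<in> set Qs \<Longrightarrow> g S = f S" for g
    using walk_queries_sound(2)[OF bs that[unfolded Qs_def]] by (rule arg_cong)
  show "outcome f (query U Qs \<bind> ?k) = return_pmf (walk f N 0 st bs)"
    using outcome_query_bind[where k = ?k, OF Qs k] by simp
  have "cost_le f (query U Qs \<bind> ?k) (1 + 0) (real (length Qs) + 0)"
    by (rule cost_le_query_bind[where k = ?k, OF Qs k]) simp_all
  then show "cost_le f (query U Qs \<bind> ?k) 1 (query_rate * card (cand st))"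
    using length_walk_queries_le[OF bs] by (auto simp: Qs_def intro: cost_le_mono)
qed

lemma outcome_batch:
  "outcome f (batch st) = map_pmf (walk f (card (cand st)) 0 st) (draws l (budget st) (cand st))"
  using active by (simp add: batch_def outcome_walk[simplified] map_pmf_def cong: bind_pmf_cong)

lemma cost_le_active_batch: "cost_le f (batch st) 1 (query_rate * card (cand st))"
proof -
  have "cost_le f (batch st) (0 + 1) (0 + query_rate * card (cand st))"
    unfolding batch_def using active cost_le_walk
    by (simp only: if_False de_Morgan_disj simp_thms) (intro cost_le_bind cost_le_sample, simp)
  then show ?thesis by simp
qed

end

lemma
  assumes inv: "batch_inv G W i st" and st': "st' \<in> set_pmf (outcome f (batch st))"
  shows batch_inv_batch: "batch_inv G W i st'"
    and card_cand_batch_le: "budget st' = 0 \<or> real (card (cand st')) \<le> (1 - \<delta>) * card (cand st)"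
proof -
  have "batch_inv G W i st' \<and> (budget st' = 0 \<or> real (card (cand st')) \<le> (1 - \<delta>) * card (cand st))"
  proof (cases "cand st = {} \<or> budget st = 0")
    case True
    then show ?thesis using inv st' by (auto simp: batch_def)
  next
    case False
    have st: "sampling st" "taken st \<subseteq> U" and walk: "walk_inv G W i st"
      using inv by (auto simp: batch_inv_def walk_inv_def sound_def)
    obtain bs where bs: "bs \<in> set_pmf (draws l (budget st) (cand st))"
      and st'_eq: "st' = walk f (card (cand st)) 0 st bs"
      using st' outcome_batch[OF st] False by auto
    note valid = draws_valid[OF l_pos finite_cand[OF st(1)] bs]
    show ?thesis
      unfolding st'_eq using batch_inv_walk[OF walk valid] card_cand_walk_le[OF walk valid] by simp
  qed
  then show "batch_inv G W i st'"
    "budget st' = 0 \<or> real (card (cand st')) \<le> (1 - \<delta>) * card (cand st)"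
    by auto
qed

lemma outcome_level:
  assumes "taken st \<subseteq> U" "budget st \<noteq> 0"
  shows "outcome f (level st) = map_pmf lower (outcome f (iterate T batch (refill f st)))"
  using outcome_neighbours_query[where k = "\<lambda>g. level_given g st",
      OF finite_ground assms(1) level_given_cong] assms(2)
  by (simp add: level_def level_given_def map_pmf_def)

lemma batch_inv_refill:
  assumes "level_inv G W i st" "budget st \<noteq> 0"
  shows "batch_inv G W i (refill f st)"
proof -
  have "cand (refill f st) \<inter> taken st = {}"
    using assms by (auto simp: gain_mem level_inv_def priced_def)
  moreover have "l * m \<le> card (seen st) + l * (budget st + i + of_bool (cand (refill f st) = {}))"
    using assms by (auto simp: level_inv_def)
  moreover have "credit (refill f st) = credit st" by (rule credit_cong) simp_all
  moreover have "prune f (refill f st) = refill f st" by (simp add: prune_def refill_def)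
  ultimately show ?thesis
    using assms
    by (auto simp: level_inv_def batch_inv_def walk_inv_def sampling_def sound_def
        priced_def charged_def)
qed

lemma priced_lower:
  assumes "priced st" "\<And>v. v \<in> U - seen st \<Longrightarrow> gain f (taken st) v < threshold st"
  shows "priced (lower st)"
proof (cases "budget st = 0")
  case False
  have thr: "0 < threshold st" using assms(1) by (simp add: priced_def)
  then have le: "(1 - \<delta>) * threshold st \<le> threshold st" using delta by simp
  show ?thesis
    unfolding priced_def
  proof (intro conjI ballI)
    fix v assume "v \<in> seen (lower st)"
    then show "(1 - \<delta>) * gain_pos f (taken (lower st)) v \<le> price (lower st) v"
      and "threshold (lower st) \<le> price (lower st) v"
      using assms(1) le False order_trans[OF le] by (auto simp: priced_def lower_def)
  next
    fix v assume "v \<in> U - seen (lower st)"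
    then have "gain_pos f (taken st) v \<le> threshold st" using assms(2)[of v] thr by simp
    then have "(1 - \<delta>) * gain_pos f (taken st) v \<le> (1 - \<delta>) * threshold st"
      using delta by (intro mult_left_mono) auto
    then show "(1 - \<delta>) * gain_pos f (taken (lower st)) v \<le> threshold (lower st)"
      using False by (simp add: lower_def)
  qed (use assms(1) thr delta False in \<open>auto simp: priced_def lower_def\<close>)
qed (use assms(1) in \<open>simp add: lower_def\<close>)

subsection \<open>Expected gain\<close>

definition yield_rate :: real where
  "yield_rate = (1 - \<delta>) / (l * (1 + \<delta>))"

definition surplus :: "'a sampler \<Rightarrow> real" where
  "surplus st = f (kept st) - yield_rate * credit st"

text \<open>An upper bound for the probability that \<open>v\<close> is eventually taken.\<close>

definition risk :: "'a \<Rightarrow> 'a sampler \<Rightarrow> real" where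
  "risk v st = (if v \<in> taken st then 1 else if v \<in> seen st then 0 else 1 / l)"

definition potentials :: "('a sampler \<Rightarrow> real) set" where
  "potentials = insert surplus (range (\<lambda>v st. - risk v st))"

lemma yield_rate_nonneg: "0 \<le> yield_rate"
  using delta by (simp add: yield_rate_def)

lemma potentials_cong:
  assumes "\<phi> \<in> potentials"
    and "taken st = taken st'" "kept st = kept st'" "seen st = seen st'" "price st = price st'"
  shows "\<phi> st = \<phi> st'"
  using assms by (auto simp: potentials_def surplus_def risk_def credit_def)

lemma expect_walk_ge:
  assumes I: "\<And>st. I st \<Longrightarrow> finite (cand st)"
      "\<And>st b. I st \<Longrightarrow> 0 < budget st \<Longrightarrow> cand st \<noteq> {} \<Longrightarrow> valid_draw l (cand st) b \<Longrightarrow> I (absorb f b st)"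
    and halt: "\<And>i st. I st \<Longrightarrow> budget st = 0 \<or> cand st = {} \<or> halts f N i st \<Longrightarrow>
      \<Psi> i st \<le> \<phi> (prune f st)"
    and step: "\<And>i st. I st \<Longrightarrow> 0 < budget st \<Longrightarrow> cand st \<noteq> {} \<Longrightarrow> \<not> halts f N i st \<Longrightarrow>
      \<Psi> i st \<le> expect (draw l (cand st)) (\<lambda>b. \<Psi> (Suc i) (absorb f b st))"
    and "I st"
  shows "\<Psi> i st \<le> expect (draws l (budget st) (cand st)) (\<lambda>bs. \<phi> (walk f N i st bs))"
  using assms(5)
proof (induction "budget st" arbitrary: st i)
  case 0
  then show ?case using halt[of st i] by (simp flip: 0(1))
next
  case (Suc n)
  note fin = I(1)[OF Suc.prems] and budget = Suc.hyps(2)[symmetric]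
  show ?case
  proof (cases "cand st = {} \<or> halts f N i st")
    case True
    have "\<phi> (walk f N i st bs) = \<phi> (prune f st)"
      if "bs \<in> set_pmf (draws l (budget st) (cand st))" for bs
      using draws_valid[OF l_pos fin that] True by (cases bs) auto
    then have "expect (draws l (budget st) (cand st)) (\<lambda>bs. \<phi> (walk f N i st bs)) = \<phi> (prune f st)"
      by (subst expect_cong) auto
    then show ?thesis using halt[OF Suc.prems] True by simp
  next
    case False
    have "\<Psi> i st \<le> expect (draw l (cand st)) (\<lambda>b. \<Psi> (Suc i) (absorb f b st))"
      using False budget by (intro step Suc.prems) auto
    also have "\<dots> \<le> expect (draw l (cand st))
        (\<lambda>b. expect (draws l n (cand st - fst b)) (\<lambda>bs. \<phi> (walk f N i st (b # bs))))"
    proof (rule expect_mono[OF finite_draw[OF l_pos fin]])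
      fix b assume "b \<in> set_pmf (draw l (cand st))"
      then have "I (absorb f b st)"
        using False budget by (intro I(2) Suc.prems draw_valid[OF l_pos fin]) auto
      then show "\<Psi> (Suc i) (absorb f b st) \<le>
          expect (draws l n (cand st - fst b)) (\<lambda>bs. \<phi> (walk f N i st (b # bs)))"
        using Suc.hyps(1)[of "absorb f b st" "Suc i"] False budget by simp
    qed
    also have "\<dots> = expect (draws l (budget st) (cand st)) (\<lambda>bs. \<phi> (walk f N i st bs))"
      unfolding budget using False by (intro expect_draws_Suc[OF l_pos fin, symmetric]) simp
    finally show ?thesis .
  qed
qed

lemma expect_risk_absorb:
  assumes "priced st" "sampling st"
  shows "expect (draw l (cand st)) (\<lambda>b. risk v (absorb f b st)) = risk v st"
proof -
  note fin = finite_cand[OF assms(2)]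
  have "((\<Sum>a\<in>B. risk v (absorb f (B, Some a) st)) +
      (real l - card B) * risk v (absorb f (B, None) st)) / l
      = risk v st" if B: "B \<in> set_pmf (block l (cand st))" for B
  proof -
    have sub: "B \<subseteq> cand st" and finB: "finite B"
      using B fin by (auto simp: set_block intro: finite_subset)
    show ?thesis
    proof (cases "v \<in> B")
      case True
      then have new: "v \<notin> taken st" "v \<notin> seen st" using sub assms(2) by (auto simp: sampling_def)
      have "(\<Sum>a\<in>B. risk v (absorb f (B, Some a) st)) = (\<Sum>a\<in>B. if v = a then 1 else 0)"
        using True new by (intro sum.cong) (auto simp: risk_def)
      then show ?thesis using True new finB by (simp add: risk_def)
    next
      case False
      then have "risk v (absorb f (B, Some a) st) = risk v st" if "a \<in> B" for a
        using that by (auto simp: risk_def)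
      moreover have "risk v (absorb f (B, None) st) = risk v st" using False by (simp add: risk_def)
      ultimately show ?thesis using l_pos by (simp add: field_simps)
    qed
  qed
  then show ?thesis
    unfolding expect_draw[OF l_pos fin] by (subst expect_cong[where h = "\<lambda>_. risk v st"]) auto
qed

lemma batch_raises_neg_risk:
  assumes inv: "batch_inv G W i st" and active: "cand st \<noteq> {}" "budget st \<noteq> 0"
  shows "- risk v st \<le> expect (draws l (budget st) (cand st)) (\<lambda>bs. - risk v (walk f N j st bs))"
proof (rule expect_walk_ge[where I = "walk_inv G W i" and \<Psi> = "\<lambda>_ st. - risk v st"])
  show "walk_inv G W i st" using inv by (simp add: batch_inv_def)
  fix s assume s: "walk_inv G W i s"
  then have ps: "priced s" "sampling s" and sound: "sound G s" by (auto simp: walk_inv_def)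
  show "finite (cand s)" using ps(2) by (rule finite_cand)
  show "walk_inv G W i (absorb f b s)"
    if "0 < budget s" "cand s \<noteq> {}" "valid_draw l (cand s) b" for b
    using that by (intro walk_inv_absorb ps sound s)
  show "- risk v s \<le> - risk v (prune f s)" by (simp add: risk_def)
  show "- risk v s \<le> expect (draw l (cand s)) (\<lambda>b. - risk v (absorb f b s))"
    using expect_risk_absorb[OF ps, of v] by simp
qed

text \<open>
  \<open>debt\<close> bounds, in units of \<open>yield_rate * threshold st * l\<close>, the expected loss of surplus in the
  rest of the walk. Each block drawn while candidates are plenty saves \<open>\<delta>\<close> units, and each block drawn
  between that moment and the next checkpoint loses one unit.
\<close>

definition debt :: "nat \<Rightarrow> nat \<Rightarrow> 'a sampler \<Rightarrow> real" where
  "debt N i st = (if cand st = {} then 0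
     else if plenty f N st then \<delta> * i
     else real (next_checkpoint \<delta> i) - i)"

lemma debt_nonneg: "0 \<le> debt N i st"
  using delta next_checkpoint_ge[OF delta(1), of i] by (simp add: debt_def)

lemma debt_Suc_le: "debt N (Suc i) st \<le> \<delta> * Suc i"
  using delta next_checkpoint_le[OF delta(1), of "Suc i"] by (auto simp: debt_def algebra_simps)

definition net_surplus :: "nat \<Rightarrow> nat \<Rightarrow> 'a sampler \<Rightarrow> real" where
  "net_surplus N i st = surplus st - yield_rate * threshold st * l * debt N i st"

context
  fixes st :: "'a sampler" and G :: "'a set" and N :: nat
  assumes priced: "priced st" and sampling: "sampling st" and sound: "sound G st"
    and cand: "cand st \<noteq> {}" "card (cand st) \<le> N"
begin

lemma surplus_absorb_ge:
  assumes "valid_draw l (cand st) b"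
  shows "surplus st + (case snd b of None \<Rightarrow> 0 | Some a \<Rightarrow> gain_pos f (taken st) a)
      - yield_rate * (threshold st * card (fst b)) \<le> surplus (absorb f b st)"
proof -
  have "f (kept st) + (case snd b of None \<Rightarrow> 0 | Some a \<Rightarrow> gain_pos f (taken st) a)
      \<le> f (kept (absorb f b st))"
    using kept_absorb(1)[OF priced sampling assms sound] by (cases "snd b") auto
  then show ?thesis
    unfolding surplus_def credit_absorb[OF priced sampling assms] by (simp add: distrib_left)
qed

lemma expect_surplus_absorb_ge:
  fixes b c :: nat
  defines "b \<equiv> min l (card (cand st))" and "c \<equiv> card (cand st)"
  shows "surplus st + b / c * (\<Sum>v\<in>cand st. gain_pos f (taken st) v) / l -
      yield_rate * (threshold st * b)
    \<le> expect (draw l (cand st)) (\<lambda>b. surplus (absorb f b st))"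
proof -
  note fin = finite_cand[OF sampling]
  let ?g = "gain_pos f (taken st)"
  define s where "s = surplus st - yield_rate * (threshold st * b)"
  have "surplus st + b / c * (\<Sum>v\<in>cand st. ?g v) / l - yield_rate * (threshold st * b)
      = s + expect (block l (cand st)) (\<lambda>B. \<Sum>v\<in>B. ?g v / l)"
    using expect_block_sum[OF fin, of l "\<lambda>v. ?g v / l"]
    by (simp add: s_def b_def c_def flip: sum_divide_distrib)
  also have "\<dots> = expect (block l (cand st)) (\<lambda>B. s + (\<Sum>v\<in>B. ?g v / l))"
    using finite_block[OF fin] by (simp add: expect_add)
  also have "\<dots> = expect (draw l (cand st)) (\<lambda>b. s + (case snd b of None \<Rightarrow> 0 | Some a \<Rightarrow> ?g a))"
    unfolding expect_draw[OF l_pos fin] using l_pos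
    by (intro expect_cong) (simp add: sum.distrib field_simps flip: sum_divide_distrib)
  also have "\<dots> \<le> expect (draw l (cand st)) (\<lambda>b. surplus (absorb f b st))"
  proof (rule expect_mono[OF finite_draw[OF l_pos fin]])
    fix d assume "d \<in> set_pmf (draw l (cand st))"
    then have d: "valid_draw l (cand st) d" by (rule draw_valid[OF l_pos fin])
    then have "card (fst d) = b" by (simp add: valid_draw_def b_def)
    then show "s + (case snd d of None \<Rightarrow> 0 | Some a \<Rightarrow> ?g a) \<le> surplus (absorb f d st)"
      using surplus_absorb_ge[OF d] by (simp add: s_def)
  qed
  finally show ?thesis .
qed

lemma plenty_sum_gain_pos_ge:
  assumes "plenty f N st"
  shows "(1 - \<delta>) * threshold st * card (cand st) \<le> (\<Sum>v\<in>cand st. gain_pos f (taken st) v)"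
proof -
  let ?g = "gain_pos f (taken st)"
  have "(1 - \<delta>) * card (cand st) \<le> (1 - \<delta>) * N" using cand delta by (intro mult_left_mono) auto
  then have "(1 - \<delta>) * card (cand st) \<le> card (cand (prune f st))"
    using assms unfolding plenty_def by linarith
  then have "threshold st * ((1 - \<delta>) * card (cand st)) \<le> threshold st * card (cand (prune f st))"
    using priced by (intro mult_left_mono) (auto simp: priced_def)
  also have "\<dots> = (\<Sum>v\<in>cand (prune f st). threshold st)" by simp
  also have "\<dots> \<le> (\<Sum>v\<in>cand (prune f st). ?g v)" by (intro sum_mono) auto
  also have "\<dots> \<le> (\<Sum>v\<in>cand st. ?g v)" using finite_cand[OF sampling] by (intro sum_mono2) auto
  finally show ?thesis by (simp add: mult_ac)
qed

lemma expect_surplus_drift: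
  "surplus st + yield_rate * threshold st * (if plenty f N st then \<delta> else - 1) *
      min l (card (cand st))
    \<le> expect (draw l (cand st)) (\<lambda>b. surplus (absorb f b st))"
proof -
  let ?S = "\<Sum>v\<in>cand st. gain_pos f (taken st) v"
  define b c where "b = real (min l (card (cand st)))" and "c = real (card (cand st))"
  have c: "0 < c" using cand finite_cand[OF sampling] by (simp add: c_def card_gt_0_iff)
  have "yield_rate * threshold st * (if plenty f N st then 1 + \<delta> else 0) * b \<le> b / c * ?S / l"
  proof (cases "plenty f N st")
    case True
    then have "b / c * ((1 - \<delta>) * threshold st * c) / l \<le> b / c * ?S / l"
      using plenty_sum_gain_pos_ge
      by (intro divide_right_mono mult_left_mono) (auto simp: b_def c_def)
    moreover have "b / c * ((1 - \<delta>) * threshold st * c) / l = yield_rate * threshold st * (1 + \<delta>) * b"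
      using c delta by (simp add: yield_rate_def)
    ultimately show ?thesis using True by simp
  next
    case False
    then show ?thesis
      by (auto simp: b_def c_def intro!: divide_nonneg_nonneg mult_nonneg_nonneg sum_nonneg)
  qed
  then show ?thesis
    using expect_surplus_absorb_ge by (auto simp: b_def c_def algebra_simps)
qed

lemma not_plenty_absorb:
  assumes "valid_draw l (cand st) b" "\<not> plenty f N st"
  shows "\<not> plenty f N (absorb f b st)"
proof -
  have "gain f (taken (absorb f b st)) v \<le> gain f (taken st) v" if "v \<in> cand (absorb f b st)" for v
    using that assms(1) sound sampling
    by (intro gain_antimono) (auto simp: sound_def sampling_def valid_draw_def)
  then have "cand (prune f (absorb f b st)) \<subseteq> cand (prune f st)" by force
  then have "card (cand (prune f (absorb f b st))) \<le> card (cand (prune f st))"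
    using finite_cand[OF sampling] by (intro card_mono) auto
  then show ?thesis using assms(2) unfolding plenty_def by linarith
qed

lemma debt_absorb:
  assumes b: "valid_draw l (cand st) b" and go: "\<not> halts f N i st"
  shows "debt N (Suc i) (absorb f b st) \<le>
    debt N i st + (if plenty f N st then \<delta> else - 1) * card (fst b) / l"
proof (cases "card (fst b) = l")
  case True
  show ?thesis
  proof (cases "plenty f N st")
    case True
    then show ?thesis using debt_Suc_le[of N i "absorb f b st"] \<open>card (fst b) = l\<close> cand l_pos
      by (simp add: debt_def algebra_simps)
  next
    case False
    then have i: "\<not> checkpoint \<delta> i" using go by (simp add: halts_def)
    then have "debt N (Suc i) (absorb f b st) \<le> real (next_checkpoint \<delta> i) - Suc i"
      using not_plenty_absorb[OF b False] next_checkpoint_Suc[OF delta(1) i]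
      by (simp add: debt_def del: absorb_simps)
    then show ?thesis using True False cand l_pos by (simp add: debt_def)
  qed
next
  case False
  then have "fst b = cand st"
    using b card_subset_eq[OF finite_cand[OF sampling], of "fst b"]
    by (auto simp: valid_draw_def min_def split: if_splits)
  then have paid: "debt N (Suc i) (absorb f b st) = 0" by (simp add: debt_def)
  show ?thesis
  proof (cases "plenty f N st")
    case True
    then show ?thesis using paid debt_nonneg[of N i st] delta by simp
  next
    case False
    then have "1 \<le> debt N i st"
      using next_checkpoint_Suc(2)[OF delta(1), of i] go cand by (simp add: debt_def halts_def)
    moreover have "real (card (fst b)) / l \<le> 1" using b l_pos by (simp add: valid_draw_def)
    ultimately show ?thesis using paid False by simp
  qed
qed

lemma net_surplus_le_expect_absorb:
  assumes "\<not> halts f N i st"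
  shows "net_surplus N i st \<le> expect (draw l (cand st)) (\<lambda>b. net_surplus N (Suc i) (absorb f b st))"
proof -
  note fin = finite_cand[OF sampling]
  define sign where "sign = (if plenty f N st then \<delta> else - 1)"
  let ?b = "min l (card (cand st))" and ?unit = "yield_rate * threshold st * l"
  have unit: "0 \<le> ?unit" using yield_rate_nonneg priced by (simp add: priced_def)
  have "net_surplus N i st \<le> expect (draw l (cand st)) (\<lambda>b. surplus (absorb f b st)) -
      ?unit * (debt N i st + sign * ?b / l)"
    using expect_surplus_drift[folded sign_def] l_pos
    by (simp add: net_surplus_def distrib_left mult_ac)
  also have "\<dots> = expect (draw l (cand st))
      (\<lambda>b. surplus (absorb f b st) - ?unit * (debt N i st + sign * ?b / l))"
    by (simp add: expect_diff finite_draw l_pos fin)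
  also have "\<dots> \<le> expect (draw l (cand st)) (\<lambda>b. net_surplus N (Suc i) (absorb f b st))"
  proof (rule expect_mono[OF finite_draw[OF l_pos fin]])
    fix b assume "b \<in> set_pmf (draw l (cand st))"
    then have b: "valid_draw l (cand st) b" by (rule draw_valid[OF l_pos fin])
    then have "debt N (Suc i) (absorb f b st) \<le> debt N i st + sign * ?b / l"
      using debt_absorb[OF b assms, folded sign_def] by (simp add: valid_draw_def)
    from mult_left_mono[OF this unit]
    show "surplus (absorb f b st) - ?unit * (debt N i st + sign * ?b / l)
        \<le> net_surplus N (Suc i) (absorb f b st)" by (simp add: net_surplus_def)
  qed
  finally show ?thesis .
qed

end

lemma batch_raises_surplus:
  assumes inv: "batch_inv G W i st" and active: "cand st \<noteq> {}" "budget st \<noteq> 0"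
  shows "surplus st \<le> expect (draws l (budget st) (cand st))
    (\<lambda>bs. surplus (walk f (card (cand st)) 0 st bs))"
proof -
  define N where "N = card (cand st)"
  have "net_surplus N 0 st \<le> expect (draws l (budget st) (cand st)) (\<lambda>bs. surplus (walk f N 0 st bs))"
  proof (rule expect_walk_ge[where I = "\<lambda>s. walk_inv G W i s \<and> card (cand s) \<le> N"])
    show "walk_inv G W i st \<and> card (cand st) \<le> N" using inv by (simp add: batch_inv_def N_def)
    fix s assume s: "walk_inv G W i s \<and> card (cand s) \<le> N"
    then have ps: "priced s" "sampling s" "sound G s" by (auto simp: walk_inv_def)
    show fin: "finite (cand s)" using ps(2) by (rule finite_cand)
    show "walk_inv G W i (absorb f b s) \<and> card (cand (absorb f b s)) \<le> N"
      if "0 < budget s" "cand s \<noteq> {}" "valid_draw l (cand s) b" for b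
    proof -
      have "card (cand s - fst b) \<le> card (cand s)" using fin by (intro card_mono) auto
      then show ?thesis using walk_inv_absorb[OF ps(1,2) that(3) ps(3)] that s by simp
    qed
    fix j
    have "0 \<le> yield_rate * threshold s * l * debt N j s"
      using yield_rate_nonneg debt_nonneg ps(1) by (simp add: priced_def)
    then show "net_surplus N j s \<le> surplus (prune f s)"
      by (simp add: net_surplus_def surplus_def credit_def)
    show "net_surplus N j s \<le> expect (draw l (cand s)) (\<lambda>b. net_surplus N (Suc j) (absorb f b s))"
      if "cand s \<noteq> {}" "\<not> halts f N j s"
      using ps that s by (intro net_surplus_le_expect_absorb) auto
  qed
  moreover have "plenty f N st"
  proof -
    have "0 < N"
      using inv active finite_cand by (auto simp: N_def card_gt_0_iff batch_inv_def walk_inv_def)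
    then show ?thesis using inv delta by (simp add: plenty_def N_def batch_inv_def del: prune_simps)
  qed
  ultimately show ?thesis using active by (simp add: net_surplus_def debt_def N_def)
qed

lemma batch_raises_potential:
  assumes inv: "batch_inv G W i st" and \<phi>: "\<phi> \<in> potentials"
  shows "raises_mean \<phi> st (outcome f (batch st))"
proof (cases "cand st = {} \<or> budget st = 0")
  case True
  then show ?thesis by (simp add: batch_def)
next
  case False
  have st: "sampling st" "taken st \<subseteq> U"
    using inv by (auto simp: batch_inv_def walk_inv_def sound_def)
  have "\<phi> st \<le> expect (draws l (budget st) (cand st)) (\<lambda>bs. \<phi> (walk f (card (cand st)) 0 st bs))"
    using \<phi> batch_raises_surplus[OF inv] batch_raises_neg_risk[OF inv] False
    by (auto simp: potentials_def)
  then show ?thesis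
    using False outcome_batch[OF st] finite_draws[OF l_pos finite_cand[OF st(1)]]
    by (simp add: raises_mean_def)
qed

lemma level_raises_potential:
  assumes inv: "level_inv G W i st" and \<phi>: "\<phi> \<in> potentials"
  shows "raises_mean \<phi> st (outcome f (level st))"
proof (cases "budget st = 0")
  case True
  then show ?thesis by (simp add: level_def)
next
  case False
  have "raises_mean \<phi> (refill f st) (outcome f (iterate T batch (refill f st)))"
    using batch_raises_potential[OF _ \<phi>] batch_inv_batch batch_inv_refill[OF inv False]
    by (rule raises_mean_iterate)
  moreover have "\<phi> (refill f st) = \<phi> st" "\<phi> (lower s) = \<phi> s" for s
    using \<phi> by (auto intro: potentials_cong)
  moreover have "outcome f (level st) = map_pmf lower (outcome f (iterate T batch (refill f st)))"
    using inv False by (intro outcome_level) (auto simp: level_inv_def sound_def)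
  ultimately show ?thesis by (simp add: raises_mean_def)
qed

subsection \<open>Oracle complexity\<close>

lemma cost_le_batch:
  assumes "batch_inv G W i st"
  shows "cost_le f (batch st) 1 (if budget st = 0 then 0 else query_rate * card (cand st))"
proof (cases "cand st = {} \<or> budget st = 0")
  case True
  then show ?thesis using query_rate_nonneg by (simp add: batch_def)
next
  case False
  then show ?thesis
    using assms cost_le_active_batch by (auto simp: batch_inv_def walk_inv_def sound_def)
qed

lemma cost_le_batches:
  assumes "batch_inv G W i st"
  shows "cost_le f (iterate n batch st) n (query_rate / \<delta> * card (cand st))"
proof -
  define \<phi> where "\<phi> st = (if budget st = 0 then 0 else query_rate / \<delta> * card (cand st))"
    for st :: "'a sampler"
  have rate: "0 \<le> query_rate / \<delta>" using query_rate_nonneg delta by simp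
  have \<phi>_nonneg: "0 \<le> \<phi> x" for x
    using mult_nonneg_nonneg[OF rate of_nat_0_le_iff] by (simp add: \<phi>_def)
  have "cost_le f (iterate n batch st) (real n * 1) (\<phi> st)"
  proof (rule cost_le_iterate[where I = "batch_inv G W i" and \<phi> = "\<lambda>_. \<phi>",
        OF cost_le_batch batch_inv_batch])
    fix n :: nat and x y assume x: "batch_inv G W i x" and y: "y \<in> set_pmf (outcome f (batch x))"
    show "(if budget x = 0 then 0 else query_rate * card (cand x)) + \<phi> y \<le> \<phi> x"
    proof (cases "budget x = 0")
      case True
      then show ?thesis using y by (simp add: \<phi>_def batch_def)
    next
      case False
      have "\<phi> y \<le> query_rate / \<delta> * ((1 - \<delta>) * card (cand x))"
        using card_cand_batch_le[OF x y] rate delta mult_left_mono[OF _ rate]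
          mult_nonneg_nonneg[OF rate]
        by (auto simp: \<phi>_def)
      also have "\<dots> = \<phi> x - query_rate * card (cand x)"
        using False delta by (simp add: \<phi>_def field_simps)
      finally show ?thesis using False by simp
    qed
  qed (use assms \<phi>_nonneg in auto)
  moreover have "\<phi> st \<le> query_rate / \<delta> * card (cand st)"
    using mult_nonneg_nonneg[OF rate of_nat_0_le_iff] by (simp add: \<phi>_def)
  ultimately show ?thesis by (auto intro: cost_le_mono)
qed

definition level_queries :: real where
  "level_queries = card U + 1 + query_rate / \<delta> * card U"

lemma level_queries_nonneg: "0 \<le> level_queries"
  using query_rate_nonneg delta by (simp add: level_queries_def)

lemma cost_le_level:
  assumes inv: "level_inv G W i st"
  shows "cost_le f (level st) (1 + real T) level_queries"
proof (cases "budget st = 0")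
  case True
  then show ?thesis using level_queries_nonneg by (simp add: level_def)
next
  case False
  have taken: "taken st \<subseteq> U" using inv by (simp add: level_inv_def sound_def)
  have "card (cand (refill f st)) \<le> card U" using finite_ground by (intro card_mono) auto
  then have "query_rate / \<delta> * card (cand (refill f st)) \<le> query_rate / \<delta> * card U"
    using query_rate_nonneg delta by (intro mult_left_mono) auto
  then have "cost_le f (iterate T batch (refill f st)) T (query_rate / \<delta> * card U)"
    by (rule cost_le_mono[OF cost_le_batches[OF batch_inv_refill[OF inv False]] order_refl])
  then have "cost_le f (level_given f st) (real T + 0) (query_rate / \<delta> * card U + 0)"
    unfolding level_given_def by (rule cost_le_bind) simp
  from cost_le_neighbours_query[where k = "\<lambda>g. level_given g st",
      OF finite_ground taken level_given_cong this]
  show ?thesis using False by (simp add: level_def level_queries_def add.assoc)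
qed

end

section \<open>Boosting steps\<close>

context submodular_fun
begin

definition boosts :: "nat \<Rightarrow> nat \<Rightarrow> real \<Rightarrow> 'a set \<Rightarrow> 'a set \<Rightarrow> 'a set pmf \<Rightarrow> bool" where
  "boosts l m \<beta> Z G D \<longleftrightarrow> finite (set_pmf D) \<and>
     (\<forall>G'\<in>set_pmf D. G' \<subseteq> U \<and> card G' \<le> card G + m) \<and>
     (1 - 1 / l) * f (Z \<union> G) \<le> expect D (\<lambda>G'. f (Z \<union> G')) \<and>
     f G + \<beta> / l * ((1 - 1 / l) * f (Z \<union> G) - expect D f) \<le> expect D f"

lemma boosts_expect_ge:
  assumes "0 < l" "0 \<le> \<beta>" "\<beta> \<le> 1" "boosts l m \<beta> Z G D"
  shows "(1 - 1 / l) * f G + \<beta> / l * (1 - 1 / l)\<^sup>2 * f (Z \<union> G) \<le> expect D f"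
proof -
  define t where "t = 1 - 1 / real l"
  have t: "0 \<le> t" "t \<le> 1" using assms(1) by (auto simp: t_def field_simps)
  have "0 \<le> expect D f" using assms(4) by (intro expect_nonneg nonneg) (simp add: boosts_def)
  moreover have "t * (1 + \<beta> / l) \<le> 1"
  proof -
    have "t * (1 + \<beta> / l) \<le> t * (1 + 1 / l)"
      using assms t by (intro mult_left_mono add_left_mono divide_right_mono) auto
    also have "\<dots> = 1 - (1 / l)\<^sup>2" by (simp add: t_def algebra_simps power2_eq_square)
    also have "\<dots> \<le> 1" by simp
    finally show ?thesis .
  qed
  ultimately have "t * (1 + \<beta> / l) * expect D f \<le> 1 * expect D f" by (intro mult_right_mono)
  moreover have "t * (f G + \<beta> / l * t * f (Z \<union> G)) \<le> t * ((1 + \<beta> / l) * expect D f)"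
    using assms(4) t by (intro mult_left_mono) (auto simp: boosts_def t_def algebra_simps)
  ultimately show ?thesis unfolding t_def[symmetric] by (simp add: algebra_simps power2_eq_square)
qed

definition solves :: "nat \<Rightarrow> real \<Rightarrow> ('a, 'a set) program \<Rightarrow> bool" where
  "solves k v P \<longleftrightarrow> (\<forall>G\<in>set_pmf (outcome f P). G \<subseteq> U \<and> card G \<le> k) \<and> v \<le> expect (outcome f P) f"

context
  fixes l m :: nat and \<beta> :: real and Z :: "'a set" and P :: "'a set \<Rightarrow> ('a, 'a set) program"
  assumes boosts: "\<And>G. G \<subseteq> U \<Longrightarrow> boosts l m \<beta> Z G (outcome f (P G))"
begin

lemma finite_iterate_boosts: "G \<subseteq> U \<Longrightarrow> finite (set_pmf (outcome f (iterate n P G)))"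
proof (induction n arbitrary: G)
  case (Suc n)
  have "finite (set_pmf (outcome f (P G)))" "\<And>G'. G' \<in> set_pmf (outcome f (P G)) \<Longrightarrow> G' \<subseteq> U"
    using boosts[OF Suc.prems] by (auto simp: boosts_def)
  then show ?case using Suc.IH by simp
qed simp

lemma iterate_boosts_subset:
  assumes "G \<subseteq> U" "G' \<in> set_pmf (outcome f (iterate n P G))"
  shows "G' \<subseteq> U" "card G' \<le> card G + n * m"
proof -
  define I where "I i X \<longleftrightarrow> X \<subseteq> U \<and> card X \<le> card G + i * m" for i X
  have "I (0 + n) G'"
  proof (rule iterate_invariant[OF _ _ assms(2)])
    show "I (Suc i) Y" if "I i X" "Y \<in> set_pmf (outcome f (P X))" for i X Y
      using boosts[of X] that by (fastforce simp: I_def boosts_def)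
    show "I 0 G" using assms(1) by (simp add: I_def)
  qed
  then show "G' \<subseteq> U" "card G' \<le> card G + n * m" by (auto simp: I_def)
qed

lemma expect_iterate_boosts_ge:
  assumes l: "0 < l" and \<beta>: "0 \<le> \<beta>" "\<beta> \<le> 1" and "G \<subseteq> U"
  shows "(1 - 1 / l) ^ n * f G + n * (\<beta> / l) * (1 - 1 / l) ^ (n + 1) * f (Z \<union> G)
    \<le> expect (outcome f (iterate n P G)) f"
  using assms(4)
proof (induction n arbitrary: G)
  case (Suc n)
  define t c where "t = 1 - 1 / real l" and "c = \<beta> / l"
  have t: "0 \<le> t" and c: "0 \<le> c" using l \<beta> by (auto simp: t_def c_def)
  define D where "D = outcome f (P G)"
  note step = boosts[OF Suc.prems, folded D_def]
  have fin: "finite (set_pmf D)" and sub: "G' \<subseteq> U" if "G' \<in> set_pmf D" for G'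
    using step that by (auto simp: boosts_def)
  have finD: "finite (set_pmf D)" using step by (simp add: boosts_def)
  have "t ^ Suc n * f G + Suc n * c * t ^ (Suc n + 1) * f (Z \<union> G)
      = t ^ n * (t * f G + c * t\<^sup>2 * f (Z \<union> G)) + n * c * t ^ (n + 1) * (t * f (Z \<union> G))"
    by (simp add: algebra_simps power2_eq_square)
  also have "\<dots> \<le> t ^ n * expect D f + n * c * t ^ (n + 1) * expect D (\<lambda>G'. f (Z \<union> G'))"
  proof (intro add_mono mult_left_mono)
    show "t * f G + c * t\<^sup>2 * f (Z \<union> G) \<le> expect D f"
      using boosts_expect_ge[OF l \<beta> step] by (simp add: t_def c_def)
    show "t * f (Z \<union> G) \<le> expect D (\<lambda>G'. f (Z \<union> G'))"
      using step by (simp add: boosts_def t_def)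
  qed (use t c in simp_all)
  also have "\<dots> = expect D (\<lambda>G'. t ^ n * f G' + n * c * t ^ (n + 1) * f (Z \<union> G'))"
    by (simp add: expect_add[OF finD])
  also have "\<dots> \<le> expect D (\<lambda>G'. expect (outcome f (iterate n P G')) f)"
    using Suc.IH[OF sub] by (intro expect_mono[OF finD]) (simp add: t_def c_def)
  also have "\<dots> = expect (outcome f (iterate (Suc n) P G)) f"
    using finD sub finite_iterate_boosts by (simp add: D_def[symmetric] expect_bind)
  finally show ?case by (simp add: t_def c_def)
qed simp

lemma cost_le_iterate_boosts:
  assumes "\<And>G. G \<subseteq> U \<Longrightarrow> cost_le f (P G) R Q"
  shows "cost_le f (iterate n P {}) (n * R) (n * Q)"
proof (rule cost_le_iterate[where I = "\<lambda>G. G \<subseteq> U" and Q = "\<lambda>_. Q" and \<phi> = "\<lambda>n _. n * Q"])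
  show "G' \<subseteq> U" if "G \<subseteq> U" "G' \<in> set_pmf (outcome f (P G))" for G G'
    using boosts[OF that(1)] that(2) by (simp add: boosts_def)
qed (use assms in \<open>auto simp: algebra_simps\<close>)

lemma iterate_boosts_solves:
  assumes l: "0 < l" and \<beta>: "0 \<le> \<beta>" "\<beta> \<le> 1" and Z: "Z \<subseteq> U" and size: "l * m \<le> k"
    and \<alpha>: "\<alpha> \<le> \<beta> * (1 - 1 / l) ^ (l + 1)"
  shows "solves k (\<alpha> * f Z) (iterate l P {})"
proof -
  have "G \<subseteq> U \<and> card G \<le> k" if "G \<in> set_pmf (outcome f (iterate l P {}))" for G
    using iterate_boosts_subset[OF empty_subsetI that] size by auto
  moreover have "\<alpha> * f Z \<le> \<beta> * (1 - 1 / l) ^ (l + 1) * f Z"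
    using \<alpha> nonneg[OF Z] by (rule mult_right_mono)
  moreover have "0 \<le> (1 - 1 / l) ^ l * f {}" using l nonneg[of "{}"] by simp
  moreover have "l * (\<beta> / l) = \<beta>" using l by simp
  ultimately show ?thesis
    using expect_iterate_boosts_ge[OF l \<beta> empty_subsetI, of l] by (simp add: solves_def)
qed

end

end

section \<open>Analysis of a stage\<close>

locale threshold_stage = threshold_sampling U f \<delta> l m T L
  for U :: "'a set" and f :: "'a set \<Rightarrow> real" and \<delta> :: real and l m T L :: nat +
  fixes k :: nat
  assumes nonempty: "U \<noteq> {}" and decay_T: "(1 - \<delta>) ^ T * card U < 1"
    and decay_L: "k * (1 - \<delta>) ^ L \<le> \<delta>" and enough_blocks: "(1 - \<delta>) * k + L * l \<le> l * m"
begin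

lemma batches_exhaust:
  assumes inv: "batch_inv G W i st" and st': "st' \<in> set_pmf (outcome f (iterate T batch st))"
  shows "batch_inv G W i st' \<and> (budget st' = 0 \<or> cand st' = {})"
proof -
  define I where "I j s \<longleftrightarrow> batch_inv G W i s \<and>
    (budget s = 0 \<or> card (cand s) \<le> (1 - \<delta>) ^ j * card U)" for j s
  have "I (0 + T) st'"
  proof (rule iterate_invariant[OF _ _ st'])
    have "cand st \<subseteq> U" using inv by (auto simp: batch_inv_def walk_inv_def sampling_def)
    then show "I 0 st" using inv finite_ground by (simp add: I_def card_mono)
  next
    fix j s s' assume I: "I j s" and s': "s' \<in> set_pmf (outcome f (batch s))"
    show "I (Suc j) s'"
    proof (cases "budget s = 0")
      case True
      then show ?thesis using I s' by (simp add: I_def batch_def)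
    next
      case False
      then have "(1 - \<delta>) * card (cand s) \<le> (1 - \<delta>) * ((1 - \<delta>) ^ j * card U)"
        using I delta unfolding I_def by (intro mult_left_mono) auto
      then show ?thesis
        using I batch_inv_batch[OF _ s'] card_cand_batch_le[OF _ s'] by (fastforce simp: I_def)
    qed
  qed
  then have "batch_inv G W i st'" "budget st' = 0 \<or> card (cand st') = 0"
    using decay_T by (auto simp: I_def)
  then show ?thesis using finite_cand by (auto simp: batch_inv_def walk_inv_def)
qed

lemma level_inv_lower:
  assumes inv: "batch_inv G W i st" and finished: "budget st = 0 \<or> cand st = {}"
    and W: "W = top_gain f G"
  shows "level_inv G W (Suc i) (lower st)"
proof (cases "budget st = 0")
  case True
  have "l * (i + of_bool (cand st = {})) \<le> l * Suc i" by (intro mult_left_mono) auto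
  then show ?thesis
    using inv True by (auto simp: batch_inv_def walk_inv_def level_inv_def lower_def)
next
  case False
  then have empty: "cand st = {}" using finished by simp
  have small: "gain f (taken st) v < threshold st" if "v \<in> U - seen st" for v
    using inv that empty by (auto simp: batch_inv_def walk_inv_def sampling_def)
  then have "priced (lower st)"
    using inv by (intro priced_lower) (auto simp: batch_inv_def walk_inv_def)
  moreover have "\<not> (taken st = G \<and> seen st = {} \<and> threshold st = W)"
  proof
    assume untouched: "taken st = G \<and> seen st = {} \<and> threshold st = W"
    have "W \<in> gain f G ` U"
      unfolding W top_gain_def using finite_ground nonempty by (intro Max_in) auto
    then show False using small untouched by auto
  qed
  then have "W \<le> credit (lower st)"
    using inv credit_cong[of "lower st" st] by (auto simp: batch_inv_def walk_inv_def charged_def)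
  ultimately show ?thesis
    using inv False empty
    by (auto simp: batch_inv_def walk_inv_def level_inv_def sound_def charged_def
        lower_def algebra_simps)
qed

lemma level_inv_level:
  assumes inv: "level_inv G W i st" and W: "W = top_gain f G"
    and st': "st' \<in> set_pmf (outcome f (level st))"
  shows "level_inv G W (Suc i) st'"
proof (cases "budget st = 0")
  case True
  then show ?thesis using inv st' by (auto simp: level_def level_inv_def)
next
  case False
  have "taken st \<subseteq> U" using inv by (simp add: level_inv_def sound_def)
  then obtain s where s: "s \<in> set_pmf (outcome f (iterate T batch (refill f st)))" "st' = lower s"
    using st' outcome_level False by auto
  show ?thesis
    using batches_exhaust[OF batch_inv_refill[OF inv False] s(1)] W unfolding s(2)
    by (blast intro: level_inv_lower)
qed

lemma gain_le_top_gain: "v \<in> U \<Longrightarrow> gain f G v \<le> top_gain f G"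
  unfolding top_gain_def using finite_ground by (intro Max_ge) auto

lemma level_inv_start:
  assumes "G \<subseteq> U" and W: "0 < W" "W = top_gain f G"
  shows "level_inv G W 0 (start W G)"
proof -
  have "(1 - \<delta>) * gain_pos f G v \<le> 1 * W" if "v \<in> U" for v
    using delta W gain_le_top_gain[OF that, of G] by (intro mult_mono) auto
  then show ?thesis
    using assms by (simp add: level_inv_def start_def sound_def priced_def charged_def)
qed

lemma sum_gain_pos_le_credit:
  assumes "priced st" "Z \<subseteq> U" "card Z \<le> k"
  shows "(1 - \<delta>) * (\<Sum>z\<in>Z. gain_pos f (taken st) z)
    \<le> credit st + threshold st * (real k - card (seen st))"
proof -
  let ?g = "\<lambda>v. (1 - \<delta>) * gain_pos f (taken st) v"
  have fin: "finite Z" "finite (seen st)" using assms by (auto simp: priced_def intro: finite_sub)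
  have "(\<Sum>z\<in>Z. ?g z) = (\<Sum>z\<in>Z \<inter> seen st. ?g z) + (\<Sum>z\<in>Z - seen st. ?g z)"
    by (rule sum.Int_Diff[OF fin(1)])
  also have "\<dots> \<le> (\<Sum>z\<in>seen st \<inter> Z. price st z) + (\<Sum>z\<in>Z - seen st. threshold st)"
    unfolding Int_commute[of Z] using assms(1,2)
    by (intro add_mono sum_mono) (auto simp: priced_def)
  finally have "(\<Sum>z\<in>Z. ?g z) \<le> (\<Sum>z\<in>seen st \<inter> Z. price st z) + threshold st * card (Z - seen st)"
    by (simp add: mult.commute)
  moreover have "(\<Sum>z\<in>seen st - Z. threshold st) \<le> (\<Sum>z\<in>seen st - Z. price st z)"
    using assms(1) by (intro sum_mono) (auto simp: priced_def)
  moreover have "credit st = (\<Sum>z\<in>seen st \<inter> Z. price st z) + (\<Sum>z\<in>seen st - Z. price st z)"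
    unfolding credit_def by (rule sum.Int_Diff[OF fin(2)])
  ultimately have "(\<Sum>z\<in>Z. ?g z)
      \<le> credit st + threshold st * (real (card (Z - seen st)) - card (seen st - Z))"
    by (simp add: algebra_simps)
  also have "\<dots> \<le> credit st + threshold st * (real k - card (seen st))"
  proof (intro add_left_mono mult_left_mono)
    show "real (card (Z - seen st)) - card (seen st - Z) \<le> real k - card (seen st)"
      using card_Int_Diff[OF fin(1), of "seen st"] card_Int_Diff[OF fin(2), of Z] assms(3)
      by (simp add: Int_commute)
  qed (use assms(1) in \<open>simp add: priced_def\<close>)
  finally show ?thesis by (simp add: sum_distrib_left)
qed

lemma threshold_le_credit:
  assumes "priced st"
  shows "threshold st * card (seen st) \<le> credit st"
proof -
  have "(\<Sum>v\<in>seen st. threshold st) \<le> (\<Sum>v\<in>seen st. price st v)"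
    using assms by (intro sum_mono) (auto simp: priced_def)
  then show ?thesis by (simp add: credit_def mult.commute)
qed

lemma threshold_mult_k_le:
  assumes inv: "level_inv G W L st" and W: "0 < W" and budget: "budget st \<noteq> 0"
  shows "threshold st * k \<le> \<delta> * credit st"
proof -
  have threshold: "threshold st = (1 - \<delta>) ^ L * W" using inv budget by (simp add: level_inv_def)
  show ?thesis
  proof (cases "W \<le> credit st")
    case True
    have "threshold st * k = k * (1 - \<delta>) ^ L * W" by (simp add: threshold)
    also have "\<dots> \<le> \<delta> * W" using decay_L W by (intro mult_right_mono) auto
    also have "\<dots> \<le> \<delta> * credit st" using True delta by (intro mult_left_mono) auto
    finally show ?thesis .
  next
    case False
    then have "threshold st = W" "seen st = {}" using inv by (auto simp: level_inv_def charged_def)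
    then have "real k < 1" "credit st = 0"
      using threshold W decay_L delta by (simp_all add: credit_def)
    then show ?thesis by simp
  qed
qed

lemma card_seen_ge:
  assumes "level_inv G W L st" "budget st = 0"
  shows "(1 - \<delta>) * k \<le> card (seen st)"
proof -
  have "l * m \<le> card (seen st) + L * l" using assms by (simp add: level_inv_def mult.commute)
  then have "real (l * m) \<le> card (seen st) + L * l" by (simp only: of_nat_le_iff flip: of_nat_add)
  then show ?thesis using enough_blocks by simp
qed

lemma threshold_deficit_le:
  assumes inv: "level_inv G W L st" and W: "0 < W"
  shows "(1 - \<delta>) * (threshold st * (real k - card (seen st))) \<le> \<delta> * credit st"
proof -
  let ?w = "threshold st" and ?s = "real (card (seen st))"
  have priced: "priced st" using inv by (simp add: level_inv_def)
  then have w: "0 < ?w" by (simp add: priced_def)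
  have credit: "?w * ?s \<le> credit st" using priced by (rule threshold_le_credit)
  moreover have "0 \<le> ?w * ?s" using w by simp
  ultimately have nonneg: "0 \<le> credit st" by linarith
  show ?thesis
  proof (cases "budget st = 0")
    case True
    note s = card_seen_ge[OF inv True]
    then have "(1 - \<delta>) * (?w * (real k - ?s)) \<le> (1 - \<delta>) * (?w * (\<delta> * k))"
      using w delta by (intro mult_left_mono) (auto simp: algebra_simps)
    also have "\<dots> = \<delta> * (?w * ((1 - \<delta>) * k))" by simp
    also have "\<dots> \<le> \<delta> * (?w * ?s)" using s w delta by (intro mult_left_mono) auto
    also have "\<dots> \<le> \<delta> * credit st" using credit delta by (intro mult_left_mono) auto
    finally show ?thesis .
  next
    case False
    have "?w * (real k - ?s) \<le> ?w * k" using w by (intro mult_left_mono) auto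
    also have "\<dots> \<le> \<delta> * credit st" by (rule threshold_mult_k_le[OF inv W False])
    finally have "(1 - \<delta>) * (?w * (real k - ?s)) \<le> (1 - \<delta>) * (\<delta> * credit st)"
      using delta by (intro mult_left_mono) auto
    also have "\<dots> \<le> \<delta> * credit st" using delta nonneg by (intro mult_left_le_one_le) auto
    finally show ?thesis .
  qed
qed

lemma optimum_gap_le_credit:
  assumes inv: "level_inv G W L st" and W: "0 < W" and Z: "Z \<subseteq> U" "card Z \<le> k"
  shows "(1 - \<delta>)\<^sup>2 * (f (Z \<union> taken st) - f (kept st)) \<le> credit st"
proof -
  let ?S = "\<Sum>z\<in>Z. gain_pos f (taken st) z"
  have st: "priced st" "taken st \<subseteq> U" "f (taken st) \<le> f (kept st)"
    using inv by (auto simp: level_inv_def sound_def)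
  have "f (Z \<union> taken st) - f (kept st) \<le> ?S"
    using union_le_sum_gain_pos[OF Z(1) st(2)] st(3) by linarith
  then have "(1 - \<delta>)\<^sup>2 * (f (Z \<union> taken st) - f (kept st)) \<le> (1 - \<delta>) * ((1 - \<delta>) * ?S)"
    unfolding power2_eq_square mult.assoc using delta by (intro mult_left_mono) auto
  also have "\<dots> \<le> (1 - \<delta>) * (credit st + threshold st * (real k - card (seen st)))"
    using sum_gain_pos_le_credit[OF st(1) Z] delta by (intro mult_left_mono) auto
  also have "\<dots> \<le> credit st"
    using threshold_deficit_le[OF inv W] by (simp add: algebra_simps)
  finally show ?thesis .
qed

lemma outcome_stage:
  assumes "G \<subseteq> U"
  shows "outcome f (stage G) = (if top_gain f G \<le> 0 then return_pmf G
    else map_pmf kept (outcome f (iterate L level (start (top_gain f G) G))))"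
  using outcome_neighbours_query[where k = "\<lambda>g. stage_given g G",
      OF finite_ground assms stage_given_cong]
  by (simp add: stage_def stage_given_def map_pmf_def)

context
  fixes G Z :: "'a set"
  assumes G: "G \<subseteq> U" and Z: "Z \<subseteq> U" "card Z \<le> k" and W: "0 < top_gain f G"
begin

abbreviation "stage_end \<equiv> outcome f (iterate L level (start (top_gain f G) G))"

lemma stage_end_level_inv:
  assumes "st \<in> set_pmf stage_end"
  shows "level_inv G (top_gain f G) L st"
proof -
  have "level_inv G (top_gain f G) (0 + L) st"
  proof (rule iterate_invariant[OF _ _ assms])
    show "level_inv G (top_gain f G) 0 (start (top_gain f G) G)"
      by (rule level_inv_start[OF G W refl])
    show "level_inv G (top_gain f G) (Suc i) y"
      if "level_inv G (top_gain f G) i x" "y \<in> set_pmf (outcome f (level x))" for i x y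
      using that(1) refl that(2) by (rule level_inv_level)
  qed
  then show ?thesis by simp
qed

lemma stage_end_raises_potential:
  assumes "\<phi> \<in> potentials"
  shows "raises_mean \<phi> (start (top_gain f G) G) stage_end"
proof (rule raises_mean_iterate[where I = "\<lambda>st. \<exists>i. level_inv G (top_gain f G) i st"])
  show "\<exists>i. level_inv G (top_gain f G) i (start (top_gain f G) G)"
    using level_inv_start[OF G W refl] by blast
  fix x assume x: "\<exists>i. level_inv G (top_gain f G) i x"
  then show "raises_mean \<phi> x (outcome f (level x))" using level_raises_potential assms by blast
  show "\<exists>i. level_inv G (top_gain f G) i y" if "y \<in> set_pmf (outcome f (level x))" for y
    using x that level_inv_level by blast
qed

lemma finite_stage_end: "finite (set_pmf stage_end)"
  using stage_end_raises_potential[of surplus] by (simp add: raises_mean_def potentials_def)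

lemma prob_stage_end_le:
  assumes "\<And>st. st \<in> set_pmf stage_end \<Longrightarrow> A st \<subseteq> taken st - G"
  shows "expect stage_end (\<lambda>st. of_bool (v \<in> A st)) \<le> 1 / l"
proof (cases "v \<in> G")
  case True
  then have "expect stage_end (\<lambda>st. of_bool (v \<in> A st)) = expect stage_end (\<lambda>_. 0)"
    using assms by (intro expect_cong) auto
  then show ?thesis by simp
next
  case False
  have "expect stage_end (\<lambda>st. of_bool (v \<in> A st)) \<le> expect stage_end (risk v)"
    using assms by (intro expect_mono finite_stage_end) (auto simp: risk_def)
  also have "\<dots> \<le> risk v (start (top_gain f G) G)"
    using stage_end_raises_potential[of "\<lambda>st. - risk v st"]
    by (simp add: raises_mean_def potentials_def)
  also have "\<dots> = 1 / l" using False by (simp add: risk_def start_def)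
  finally show ?thesis .
qed

lemma stage_end_union_ge:
  assumes "\<And>st. st \<in> set_pmf stage_end \<Longrightarrow> G \<subseteq> A st \<and> A st \<subseteq> taken st"
  shows "(1 - 1 / l) * f (Z \<union> G) \<le> expect stage_end (\<lambda>st. f (Z \<union> A st))"
proof -
  have "taken st \<subseteq> U" if "st \<in> set_pmf stage_end" for st
    using stage_end_level_inv[OF that] by (simp add: level_inv_def sound_def)
  then have "(1 - 1 / l) * f (Z \<union> G) \<le> expect stage_end (\<lambda>st. f (Z \<union> G \<union> (A st - G)))"
    using assms G Z by (intro random_union_ge finite_stage_end prob_stage_end_le) (auto, blast+)
  also have "\<dots> = expect stage_end (\<lambda>st. f (Z \<union> A st))"
    using assms by (intro expect_cong arg_cong[of _ _ f]) auto
  finally show ?thesis .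
qed

lemma stage_end_value_ge:
  defines "\<beta> \<equiv> (1 - \<delta>) ^ 3 / (1 + \<delta>)"
  shows "f G + \<beta> / l * ((1 - 1 / l) * f (Z \<union> G) - expect stage_end (\<lambda>st. f (kept st)))
    \<le> expect stage_end (\<lambda>st. f (kept st))"
proof -
  have \<beta>: "0 \<le> \<beta>" "yield_rate * (1 - \<delta>)\<^sup>2 = \<beta> / l"
    using delta by (auto simp: \<beta>_def yield_rate_def power2_eq_square power3_eq_cube mult.commute)
  have sound: "sound G st" if "st \<in> set_pmf stage_end" for st
    using stage_end_level_inv[OF that] by (simp add: level_inv_def)
  have "f G = surplus (start (top_gain f G) G)" by (simp add: surplus_def credit_def start_def)
  also have "\<dots> \<le> expect stage_end surplus"
    using stage_end_raises_potential[of surplus] by (simp add: raises_mean_def potentials_def)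
  finally have surplus: "f G \<le> expect stage_end surplus" .
  have "(1 - 1 / l) * f (Z \<union> G) \<le> expect stage_end (\<lambda>st. f (Z \<union> taken st))"
    using sound by (intro stage_end_union_ge) (auto simp: sound_def)
  then have "\<beta> / l * ((1 - 1 / l) * f (Z \<union> G) - expect stage_end (\<lambda>st. f (kept st)))
      \<le> \<beta> / l * (expect stage_end (\<lambda>st. f (Z \<union> taken st)) - expect stage_end (\<lambda>st. f (kept st)))"
    using \<beta>(1) by (intro mult_left_mono) auto
  then have "f G + \<beta> / l * ((1 - 1 / l) * f (Z \<union> G) - expect stage_end (\<lambda>st. f (kept st)))
      \<le> expect stage_end (\<lambda>st. surplus st + \<beta> / l * (f (Z \<union> taken st) - f (kept st)))"
    using surplus by (simp add: expect_add expect_diff finite_stage_end)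
  also have "\<dots> \<le> expect stage_end (\<lambda>st. f (kept st))"
  proof (rule expect_mono[OF finite_stage_end])
    fix st assume "st \<in> set_pmf stage_end"
    then have "(1 - \<delta>)\<^sup>2 * (f (Z \<union> taken st) - f (kept st)) \<le> credit st"
      by (intro optimum_gap_le_credit[OF stage_end_level_inv W Z])
    from mult_left_mono[OF this yield_rate_nonneg]
    show "surplus st + \<beta> / l * (f (Z \<union> taken st) - f (kept st)) \<le> f (kept st)"
      unfolding \<beta>(2)[symmetric] surplus_def by (simp add: mult.assoc)
  qed
  finally show ?thesis .
qed

end

lemma stage_boosts:
  assumes G: "G \<subseteq> U" and Z: "Z \<subseteq> U" "card Z \<le> k"
  shows "boosts l m ((1 - \<delta>) ^ 3 / (1 + \<delta>)) Z G (outcome f (stage G))"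
proof (cases "top_gain f G \<le> 0")
  case True
  have "(\<Sum>z\<in>Z. gain_pos f G z) = 0"
    using gain_le_top_gain[of _ G] True Z(1) by (intro sum.neutral) (fastforce simp: max_def)
  then have "f (Z \<union> G) \<le> f G" using union_le_sum_gain_pos[OF Z(1) G] by simp
  moreover have le: "(1 - 1 / l) * f (Z \<union> G) \<le> f (Z \<union> G)"
    using l_pos G Z by (intro mult_left_le_one_le nonneg) auto
  ultimately have "(1 - \<delta>) ^ 3 / (1 + \<delta>) / l * ((1 - 1 / l) * f (Z \<union> G) - f G) \<le> 0"
    using delta by (intro mult_nonneg_nonpos) auto
  then show ?thesis using True G le by (simp add: boosts_def outcome_stage[OF G])
next
  case False
  then have W: "0 < top_gain f G" by simp
  have sound: "sound G st" if "st \<in> set_pmf (stage_end G)" for st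
    using stage_end_level_inv[OF G Z W that] by (simp add: level_inv_def)
  have "(1 - 1 / l) * f (Z \<union> G) \<le> expect (stage_end G) (\<lambda>st. f (Z \<union> kept st))"
    using sound by (intro stage_end_union_ge[OF G Z W]) (auto simp: sound_def)
  moreover have "kept st \<subseteq> U" "card (kept st) \<le> card G + m" if "st \<in> set_pmf (stage_end G)" for st
    using sound[OF that] by (auto simp: sound_def)
  ultimately show ?thesis
    using False stage_end_value_ge[OF G Z W] finite_stage_end[OF G Z W]
    by (auto simp: boosts_def outcome_stage[OF G])
qed

lemma cost_le_stage:
  assumes "G \<subseteq> U"
  shows "cost_le f (stage G)
    (1 + real L * (1 + real T)) (real (card U) + 1 + real L * level_queries)"
proof -
  let ?W = "top_gain f G"
  have "cost_le f (stage_given f G) (real L * (1 + real T)) (real L * level_queries)"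
  proof (cases "?W \<le> 0")
    case True
    then show ?thesis using level_queries_nonneg by (simp add: stage_given_def)
  next
    case False
    have "cost_le f (iterate L level (start ?W G)) (L * (1 + real T)) (L * level_queries)"
    proof (rule cost_le_iterate[where I = "\<lambda>st. \<exists>i. level_inv G ?W i st" and Q = "\<lambda>_. level_queries"])
      show "\<exists>i. level_inv G ?W i (start ?W G)" using level_inv_start[OF assms _ refl] False by auto
      fix x assume x: "\<exists>i. level_inv G ?W i x"
      then show "cost_le f (level x) (1 + real T) level_queries" using cost_le_level by blast
      show "\<exists>i. level_inv G ?W i y" if "y \<in> set_pmf (outcome f (level x))" for y
        using x that level_inv_level by blast
    qed (simp_all add: algebra_simps)
    then have "cost_le f (iterate L level (start ?W G) \<bind> (\<lambda>st. Done (kept st)))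
        (real L * (1 + real T) + 0) (real L * level_queries + 0)"
      by (rule cost_le_bind) simp
    then show ?thesis using False by (simp add: stage_given_def)
  qed
  from cost_le_neighbours_query[where k = "\<lambda>g. stage_given g G",
      OF finite_ground assms stage_given_cong this]
  show ?thesis by (simp add: stage_def add_ac)
qed

end

section \<open>Random greedy\<close>

definition top_set :: "'a set \<Rightarrow> nat \<Rightarrow> ('a \<Rightarrow> real) \<Rightarrow> 'a set" where
  "top_set U k h = arg_min_on (\<lambda>M. - (\<Sum>v\<in>M. h v)) {M. M \<subseteq> U \<and> card M \<le> k}"

lemma
  assumes "finite U"
  shows top_set_subset: "top_set U k h \<subseteq> U"
    and card_top_set_le: "card (top_set U k h) \<le> k"
    and sum_le_sum_top_set: "M \<subseteq> U \<Longrightarrow> card M \<le> k \<Longrightarrow> (\<Sum>v\<in>M. h v) \<le> (\<Sum>v\<in>top_set U k h. h v)"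
proof -
  let ?F = "{M. M \<subseteq> U \<and> card M \<le> k}"
  have fin: "finite ?F" by (rule finite_subset[of _ "Pow U"]) (use assms in auto)
  have "{} \<in> ?F" by simp
  then have ne: "?F \<noteq> {}" by blast
  show "top_set U k h \<subseteq> U" "card (top_set U k h) \<le> k"
    using arg_min_if_finite(1)[OF fin ne] by (auto simp: top_set_def)
  show "(\<Sum>v\<in>M. h v) \<le> (\<Sum>v\<in>top_set U k h. h v)" if "M \<subseteq> U" "card M \<le> k"
    using arg_min_least[OF fin ne, of M "\<lambda>M. - (\<Sum>v\<in>M. h v)"] that by (simp add: top_set_def)
qed

lemma top_set_cong:
  assumes "\<And>v. v \<in> U \<Longrightarrow> h v = h' v"
  shows "top_set U k h = top_set U k h'"
proof -
  have "(\<Sum>v\<in>M. h v) = (\<Sum>v\<in>M. h' v)" if "M \<subseteq> U" for M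
    using assms that by (intro sum.cong) auto
  then show ?thesis
    unfolding top_set_def arg_min_on_def arg_min_def is_arg_min_def
    by (intro arg_cong[where f = Eps]) auto
qed

definition greedy :: "'a set \<Rightarrow> nat \<Rightarrow> 'a set \<Rightarrow> ('a, 'a set) program" where
  "greedy U k G = do {
     g \<leftarrow> query U (neighbours U G);
     x \<leftarrow> sample (pick k (top_set U k (gain g G)));
     Done (G \<union> set_option x)
   }"

lemma legal_greedy: "legal U (greedy U k G)"
  by (simp add: greedy_def legal_bind legal_query legal_sample)

context submodular_fun
begin

lemma
  assumes "G \<subseteq> U"
  shows outcome_greedy: "outcome f (greedy U k G) =
      map_pmf (\<lambda>x. G \<union> set_option x) (pick k (top_set U k (gain f G)))"
    and cost_le_greedy: "cost_le f (greedy U k G) 1 (real (card U + 1))"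
proof -
  let ?k = "\<lambda>g. sample (pick k (top_set U k (gain g G))) \<bind> (\<lambda>x. Done (G \<union> set_option x))"
  have cong: "?k g = ?k f" if "\<And>v. v \<in> U \<Longrightarrow> gain g G v = gain f G v" for g
    using top_set_cong[of U "gain g G" "gain f G", OF that] by simp
  show "outcome f (greedy U k G) = map_pmf (\<lambda>x. G \<union> set_option x) (pick k (top_set U k (gain f G)))"
    using outcome_neighbours_query[where k = ?k, OF finite_ground assms cong]
    by (simp add: greedy_def map_pmf_def)
  have "cost_le f (?k f) (0 + 0) (0 + 0)" by (rule cost_le_bind[OF cost_le_sample]) simp
  from cost_le_neighbours_query[where k = ?k, OF finite_ground assms cong this]
  show "cost_le f (greedy U k G) 1 (real (card U + 1))" by (simp add: greedy_def)
qed

context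
  fixes G Z :: "'a set" and k :: nat
  assumes G: "G \<subseteq> U" and Z: "Z \<subseteq> U" "card Z \<le> k" and k: "0 < k"
begin

abbreviation "best \<equiv> top_set U k (gain f G)"

lemma finite_best: "finite best"
  using top_set_subset[OF finite_ground] by (rule finite_sub)

lemma set_pick_best: "x \<in> set_pmf (pick k best) \<Longrightarrow> set_option x \<subseteq> U"
  using set_option_pick[OF finite_best k] top_set_subset[OF finite_ground] by blast

lemma greedy_union_ge:
  "(1 - 1 / k) * f (Z \<union> G) \<le> expect (pick k best) (\<lambda>x. f (Z \<union> G \<union> set_option x))"
proof (rule random_union_ge)
  fix v
  have "expect (pick k best) (\<lambda>x. of_bool (v \<in> set_option x)) = (\<Sum>b\<in>best. of_bool (v = b)) / k"
    unfolding expect_pick[OF finite_best card_top_set_le[OF finite_ground] k] by simp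
  also have "\<dots> \<le> 1 / k" using finite_best by (intro divide_right_mono) (auto simp: of_bool_def)
  finally show "expect (pick k best) (\<lambda>x. of_bool (v \<in> set_option x)) \<le> 1 / k" .
qed (use G Z k finite_pick set_pick_best in auto)

lemma optimum_gap_le_sum_best:
  assumes "G \<subseteq> G'" "G' \<subseteq> U"
  shows "f (Z \<union> G') - f G' \<le> (\<Sum>b\<in>best. gain f G b)"
proof -
  have finZ: "finite Z" using Z(1) by (rule finite_sub)
  let ?Z = "{z \<in> Z. 0 < gain f G z}"
  have "f (Z \<union> G') - f G' \<le> (\<Sum>z\<in>Z. gain_pos f G' z)" using assms Z by (intro union_le_sum_gain_pos)
  also have "\<dots> \<le> (\<Sum>z\<in>Z. gain_pos f G z)" using assms Z by (intro sum_mono gain_pos_antimono) auto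
  also have "\<dots> = (\<Sum>z\<in>?Z. gain f G z)" using finZ by (intro sum.mono_neutral_cong_right) auto
  also have "\<dots> \<le> (\<Sum>b\<in>best. gain f G b)"
    using Z finZ card_mono[of Z ?Z] by (intro sum_le_sum_top_set[OF finite_ground]) auto
  finally show ?thesis .
qed

lemma greedy_boosts: "boosts k 1 1 Z G (outcome f (greedy U k G))"
proof -
  define D where "D = outcome f (greedy U k G)"
  have D: "D = map_pmf (\<lambda>x. G \<union> set_option x) (pick k best)"
    by (simp add: D_def outcome_greedy[OF G])
  have fin: "finite (set_pmf D)" using finite_pick[OF k, of best] by (simp add: D)
  have out: "G \<subseteq> G' \<and> G' \<subseteq> U \<and> card G' \<le> card G + 1" if G': "G' \<in> set_pmf D" for G'
  proof -
    obtain x where x: "x \<in> set_pmf (pick k best)" "G' = G \<union> set_option x" using G' by (auto simp: D)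
    have "card (set_option x) \<le> 1" by (cases x) auto
    then have "card G' \<le> card G + 1"
      using card_Un_le[of G "set_option x"] unfolding x(2) by linarith
    then show ?thesis using set_pick_best[OF x(1)] G x(2) by auto
  qed
  have union: "(1 - 1 / k) * f (Z \<union> G) \<le> expect D (\<lambda>G'. f (Z \<union> G'))"
    using greedy_union_ge by (simp add: D Un_assoc)
  have "expect D (\<lambda>G'. f (Z \<union> G') - f G') \<le> expect D (\<lambda>_. \<Sum>b\<in>best. gain f G b)"
    using out by (intro expect_mono[OF fin] optimum_gap_le_sum_best) auto
  then have "(1 - 1 / k) * f (Z \<union> G) - expect D f \<le> (\<Sum>b\<in>best. gain f G b)"
    using union by (simp add: expect_diff[OF fin])
  then have "1 / k * ((1 - 1 / k) * f (Z \<union> G) - expect D f) \<le> 1 / k * (\<Sum>b\<in>best. gain f G b)"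
    by (intro mult_left_mono) auto
  moreover have "expect D f = f G + 1 / k * (\<Sum>b\<in>best. gain f G b)"
    using k by (simp add: D expect_pick[OF finite_best card_top_set_le[OF finite_ground] k]
        gain_def sum_subtractf field_simps)
  ultimately have "f G + 1 / k * ((1 - 1 / k) * f (Z \<union> G) - expect D f) \<le> expect D f" by simp
  then show ?thesis using fin out union unfolding D_def by (simp add: boosts_def)
qed

end

end

section \<open>The combined algorithm\<close>

lemma one_minus_inverse_power_ge:
  assumes "2 \<le> l"
  shows "(1 - 2 / real l) / exp 1 \<le> (1 - 1 / real l) ^ (l + 1)"
proof -
  define t where "t = 1 - 1 / real l"
  have l: "real l > 1" using assms by simp
  have t: "0 < t" using l by (simp add: t_def)
  have "1 / t = 1 + 1 / (real l - 1)" using l by (simp add: t_def field_simps)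
  then have "1 / t \<le> exp (1 / (real l - 1))"
    using exp_ge_add_one_self[of "1 / (real l - 1)"] by simp
  then have "(1 / t) ^ (l - 1) \<le> exp (1 / (real l - 1)) ^ (l - 1)"
    using t by (intro power_mono) auto
  also have "\<dots> = exp 1" using l assms by (simp add: exp_of_nat_mult[symmetric] of_nat_diff)
  finally have "1 / exp 1 \<le> t ^ (l - 1)" using t by (simp add: power_one_over field_simps)
  moreover have "1 - 2 / real l \<le> t\<^sup>2" by (simp add: t_def power2_eq_square algebra_simps)
  moreover have "0 \<le> 1 - 2 / real l" using assms by simp
  ultimately have "1 / exp 1 * (1 - 2 / real l) \<le> t ^ (l - 1) * t\<^sup>2"
    using t by (intro mult_mono) auto
  also have "\<dots> = t ^ (l + 1)" using assms by (simp flip: power_add)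
  finally show ?thesis by (simp add: t_def)
qed

lemma one_minus_power_le_exp:
  fixes \<delta> :: real
  assumes "0 \<le> \<delta>" "\<delta> \<le> 1"
  shows "(1 - \<delta>) ^ n \<le> exp (- (\<delta> * n))"
proof -
  have "(1 - \<delta>) ^ n \<le> exp (- \<delta>) ^ n"
    using assms exp_ge_add_one_self[of "- \<delta>"] by (intro power_mono) auto
  then show ?thesis by (simp add: exp_of_nat_mult[symmetric] mult.commute)
qed

lemma one_minus_cube_ge:
  fixes \<delta> :: real
  assumes "0 \<le> \<delta>" "\<delta> \<le> 1"
  shows "1 - 4 * \<delta> \<le> (1 - \<delta>) ^ 3 / (1 + \<delta>)"
proof -
  have "(1 - \<delta>) ^ 3 - (1 - 4 * \<delta>) * (1 + \<delta>) = \<delta>\<^sup>2 * (7 - \<delta>)"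
    by (simp add: power3_eq_cube power2_eq_square algebra_simps)
  moreover have "0 \<le> \<delta>\<^sup>2 * (7 - \<delta>)" using assms by simp
  ultimately have "(1 - 4 * \<delta>) * (1 + \<delta>) \<le> (1 - \<delta>) ^ 3" by linarith
  then show ?thesis using assms by (simp add: le_divide_eq)
qed

definition num_stages :: "real \<Rightarrow> nat" where
  "num_stages \<epsilon> = nat \<lceil>2 / \<epsilon>\<rceil>"

definition num_batches :: "real \<Rightarrow> nat \<Rightarrow> nat" where
  "num_batches \<delta> n = nat \<lceil>ln n / \<delta>\<rceil> + 1"

definition num_levels :: "real \<Rightarrow> nat \<Rightarrow> nat" where
  "num_levels \<delta> k = nat \<lceil>ln (k / \<delta>) / \<delta>\<rceil> + 1"

lemma num_batches_decay:
  assumes "0 < \<delta>" "\<delta> < 1" "1 \<le> n"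
  shows "(1 - \<delta>) ^ num_batches \<delta> n * n < 1"
proof -
  have "ln n / \<delta> < num_batches \<delta> n" unfolding num_batches_def by linarith
  then have "ln n < \<delta> * num_batches \<delta> n" using assms by (simp add: divide_less_eq mult.commute)
  then have "exp (- (\<delta> * num_batches \<delta> n)) < exp (- ln n)" by simp
  then have "(1 - \<delta>) ^ num_batches \<delta> n < exp (- ln n)"
    using one_minus_power_le_exp[of \<delta> "num_batches \<delta> n"] assms by linarith
  also have "\<dots> = 1 / n" using assms by (simp add: exp_minus inverse_eq_divide)
  finally show ?thesis using assms by (simp add: less_divide_eq)
qed

lemma num_levels_decay:
  assumes "0 < \<delta>" "\<delta> < 1" "0 < k"
  shows "k * (1 - \<delta>) ^ num_levels \<delta> k \<le> \<delta>"
proof -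
  have "ln (k / \<delta>) / \<delta> \<le> num_levels \<delta> k" unfolding num_levels_def by linarith
  then have "ln (k / \<delta>) \<le> \<delta> * num_levels \<delta> k" using assms by (simp add: divide_le_eq mult.commute)
  then have "exp (- (\<delta> * num_levels \<delta> k)) \<le> exp (- ln (k / \<delta>))" by simp
  then have "(1 - \<delta>) ^ num_levels \<delta> k \<le> exp (- ln (k / \<delta>))"
    using one_minus_power_le_exp[of \<delta> "num_levels \<delta> k"] assms by linarith
  also have "\<dots> = \<delta> / k" using assms by (simp add: exp_minus)
  finally show ?thesis using assms by (simp add: le_divide_eq mult.commute)
qed

lemma num_levels_le:
  assumes "0 < \<delta>" "\<delta> \<le> 1" "1 / \<delta> \<le> k" "1 \<le> k"
  shows "num_levels \<delta> k \<le> 2 * ln k / \<delta> + 2"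
proof -
  have "ln (k / \<delta>) = ln k + ln (1 / \<delta>)" using assms ln_mult[of "real k" "1 / \<delta>"] by simp
  moreover have "ln (1 / \<delta>) \<le> ln k" using assms by (subst ln_le_cancel_iff) auto
  moreover have "0 \<le> ln (1 / \<delta>)" using assms by simp
  ultimately have "0 \<le> ln (k / \<delta>)" "ln (k / \<delta>) / \<delta> \<le> 2 * ln k / \<delta>"
    using assms by (auto intro!: divide_right_mono)
  moreover from this(1) have "0 \<le> ln (k / \<delta>) / \<delta>" using assms by simp
  ultimately show ?thesis unfolding num_levels_def by linarith
qed

definition round_bound :: "nat \<Rightarrow> nat \<Rightarrow> real \<Rightarrow> real" where
  "round_bound n k \<epsilon> = 1000 * (1 / \<epsilon> ^ 5) * ln n * ln k"

definition query_bound :: "nat \<Rightarrow> nat \<Rightarrow> real \<Rightarrow> real" where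
  "query_bound n k \<epsilon> = 3000 * (1 / \<epsilon> ^ 6) * n * ln n * ln k"

text \<open>
  At most \<open>(num_levels \<delta> k + 1) * l\<close> of the \<open>k\<close> elements are lost,
    by one incomplete block per level and by
  rounding \<open>k div l\<close>; the constant \<open>132\<close> makes this at most \<open>\<delta> * k\<close>.
\<close>

definition maximizer :: "'a set \<Rightarrow> nat \<Rightarrow> real \<Rightarrow> ('a, 'a set) program" where
  "maximizer U k \<epsilon> =
    (if U = {} \<or> 1 / exp 1 \<le> \<epsilon> then Done {}
     else if real k \<le> 132 * ln k / \<epsilon> ^ 3 then iterate k (greedy U k) {}
     else let l = num_stages \<epsilon>; \<delta> = \<epsilon> / 4 in
       iterate l (threshold_sampler.stage U \<delta> l (k div l)
         (num_batches \<delta> (card U)) (num_levels \<delta> k)) {})"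

lemma legal_maximizer: "legal U (maximizer U k \<epsilon>)"
  by (simp add: maximizer_def Let_def legal_iterate legal_greedy threshold_sampler.legal_stage)

lemma inverse_exp_1_le: "1 / exp 1 \<le> (1 / 2 :: real)"
  using exp_ge_add_one_self[of 1] by (intro divide_left_mono) auto

lemma ln_ge_1: "3 \<le> n \<Longrightarrow> 1 \<le> ln (real n)"
  using exp_le by (subst ln_ge_iff) auto

locale parallel_regime = submodular_fun U f for U :: "'a set" and f :: "'a set \<Rightarrow> real" +
  fixes k :: nat and \<epsilon> :: real
  assumes ground: "U \<noteq> {}" and eps: "0 < \<epsilon>" "\<epsilon> < 1 / 2" and k_ge_3: "3 \<le> k"
    and large: "132 * ln k / \<epsilon> ^ 3 < k"
begin

abbreviation "\<delta> \<equiv> \<epsilon> / 4"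
abbreviation "l \<equiv> num_stages \<epsilon>"
abbreviation "m \<equiv> k div l"
abbreviation "T \<equiv> num_batches \<delta> (card U)"
abbreviation "L \<equiv> num_levels \<delta> k"

lemma inv_eps_gt: "2 < 1 / \<epsilon>"
  using eps by (simp add: field_simps)

lemma ln_k_ge_1: "1 \<le> ln (real k)"
  using k_ge_3 by (rule ln_ge_1)

lemma card_ground_ge_1: "1 \<le> card U"
  using ground finite_ground by (simp add: Suc_le_eq card_gt_0_iff)

lemma num_stages_bounds: "2 / \<epsilon> \<le> l" "real l \<le> 3 * (1 / \<epsilon>)" "2 \<le> l"
proof -
  show ge: "2 / \<epsilon> \<le> l" unfolding num_stages_def by (rule real_nat_ceiling_ge)
  have "0 \<le> 2 / \<epsilon>" using eps by simp
  then have "real l \<le> 2 / \<epsilon> + 1" unfolding num_stages_def by linarith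
  then show "real l \<le> 3 * (1 / \<epsilon>)" using inv_eps_gt by simp
  show "2 \<le> l" using ge inv_eps_gt by linarith
qed

lemma k_gt: "132 * ln k * (1 / \<epsilon>) ^ 3 < k"
  using large by (simp add: power_one_over)

lemma num_levels_bound: "real L \<le> 10 * ln k * (1 / \<epsilon>)"
proof -
  have "(1 / \<epsilon>) ^ 1 \<le> (1 / \<epsilon>) ^ 3" using inv_eps_gt by (intro power_increasing) auto
  then have "4 * (1 / \<epsilon>) \<le> 132 * ln k * (1 / \<epsilon>) ^ 3" using ln_k_ge_1 eps by (intro mult_mono) auto
  then have "1 / \<delta> \<le> k" using k_gt by simp
  then have "real L \<le> 2 * ln k / \<delta> + 2" using eps k_ge_3 by (intro num_levels_le) auto
  also have "\<dots> \<le> 8 * ln k * (1 / \<epsilon>) + 2 * (ln k * (1 / \<epsilon>))"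
    using mult_mono[of 1 "ln k" 1 "1 / \<epsilon>"] ln_k_ge_1 inv_eps_gt by simp
  finally show ?thesis by simp
qed

lemma levels_mult_stages_le: "real (L + 1) * l \<le> \<delta> * k"
proof -
  have "1 * 1 \<le> ln k * (1 / \<epsilon>)" using ln_k_ge_1 inv_eps_gt by (intro mult_mono) auto
  then have "real (L + 1) \<le> 11 * ln k * (1 / \<epsilon>)" using num_levels_bound by simp
  then have "real (L + 1) * l \<le> (11 * ln k * (1 / \<epsilon>)) * (3 * (1 / \<epsilon>))"
    using num_stages_bounds ln_k_ge_1 eps by (intro mult_mono) auto
  also have "\<dots> = \<delta> * (132 * ln k * (1 / \<epsilon>) ^ 3)" using eps by (simp add: power3_eq_cube)
  also have "\<dots> \<le> \<delta> * k" using k_gt eps by (intro mult_left_mono) auto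
  finally show ?thesis .
qed

lemma blocks_ge: "(1 - \<delta>) * k + L * l \<le> l * m"
proof -
  have l: "0 < l" using num_stages_bounds by simp
  have "k < l * m + l" using mult_div_mod_eq[of l k] mod_less_divisor[OF l, of k] by linarith
  then have "real k \<le> real (l * m) + l" by linarith
  then show ?thesis using levels_mult_stages_le by (simp add: algebra_simps)
qed

sublocale threshold_stage U f \<delta> l m T L k
proof
  show "0 < l" using num_stages_bounds by simp
  show "(1 - \<delta>) ^ T * card U < 1" using eps card_ground_ge_1 by (intro num_batches_decay) auto
  show "k * (1 - \<delta>) ^ L \<le> \<delta>" using eps k_ge_3 by (intro num_levels_decay) auto
qed (use eps blocks_ge ground in auto)

lemma value_ratio: "1 / exp 1 - \<epsilon> \<le> (1 - \<delta>) ^ 3 / (1 + \<delta>) * (1 - 1 / l) ^ (l + 1)"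
proof -
  have "2 / real l \<le> \<epsilon>" using num_stages_bounds eps by (simp add: field_simps)
  then have "(1 - \<epsilon>) / exp 1 \<le> (1 - 2 / l) / exp 1" by (intro divide_right_mono) auto
  also have "\<dots> \<le> (1 - 1 / l) ^ (l + 1)"
    using num_stages_bounds by (intro one_minus_inverse_power_ge)
  finally have "(1 - \<epsilon>) * ((1 - \<epsilon>) / exp 1) \<le> (1 - \<delta>) ^ 3 / (1 + \<delta>) * (1 - 1 / l) ^ (l + 1)"
    using one_minus_cube_ge[of \<delta>] eps by (intro mult_mono) auto
  moreover have "1 / exp 1 - \<epsilon> \<le> (1 - \<epsilon>) * ((1 - \<epsilon>) / exp 1)"
  proof -
    have "\<epsilon> * 2 \<le> \<epsilon> * exp 1" using exp_ge_add_one_self[of 1] eps by (intro mult_left_mono) auto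
    moreover have "(1 - \<epsilon>) * (1 - \<epsilon>) = 1 - \<epsilon> * 2 + \<epsilon>\<^sup>2"
      by (simp add: algebra_simps power2_eq_square)
    ultimately have "1 - \<epsilon> * exp 1 \<le> (1 - \<epsilon>) * (1 - \<epsilon>)" using zero_le_power2[of \<epsilon>] by linarith
    then have "(1 - \<epsilon> * exp 1) / exp 1 \<le> (1 - \<epsilon>) * (1 - \<epsilon>) / exp 1"
      by (intro divide_right_mono) auto
    moreover have "(1 - \<epsilon> * exp 1) / exp 1 = 1 / exp 1 - \<epsilon>" by (simp add: diff_divide_distrib)
    ultimately show ?thesis by simp
  qed
  ultimately show ?thesis by linarith
qed

lemma iterate_stage_solves:
  assumes "Z \<subseteq> U" "card Z \<le> k"
  shows "solves k ((1 / exp 1 - \<epsilon>) * f Z) (iterate l stage {})"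
proof (rule iterate_boosts_solves[OF stage_boosts[OF _ assms]])
  show "(1 - \<delta>) ^ 3 / (1 + \<delta>) \<le> 1"
    using delta power_le_one[of "1 - \<delta>" 3] by (simp add: divide_le_eq)
qed (use assms l_pos delta value_ratio in auto)

context
  assumes card_ge_3: "3 \<le> card U"
begin

lemma ln_card_ge_1: "1 \<le> ln (real (card U))"
  using card_ge_3 by (rule ln_ge_1)

lemma num_batches_bound: "1 + real T \<le> 7 * (ln (card U) * (1 / \<epsilon>))"
proof -
  have "0 \<le> ln (card U) / \<delta>" using ln_card_ge_1 eps by simp
  then have "real T \<le> ln (card U) / \<delta> + 2" unfolding num_batches_def by linarith
  moreover have "1 * 1 \<le> ln (card U) * (1 / \<epsilon>)"
    using ln_card_ge_1 inv_eps_gt by (intro mult_mono) auto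
  ultimately show ?thesis by simp
qed

lemma query_rate_le: "query_rate \<le> 20 * (ln (card U) * (1 / \<epsilon>))"
proof -
  have "real (card U) * 2 \<le> real (card U) * real (card U)"
    using card_ge_3 by (intro mult_left_mono) auto
  moreover have "real (card U) + 1 \<le> real (card U) * 2" using card_ge_3 by simp
  ultimately have "real (card U) + 1 \<le> real (card U) ^ 2" unfolding power2_eq_square by linarith
  then have "ln (real (card U) + 1) \<le> ln (real (card U) ^ 2)" by (intro ln_mono) auto
  also have "\<dots> = 2 * ln (card U)" by (simp add: ln_realpow)
  finally have "2 * ln (real (card U) + 1) / \<delta> \<le> 2 * (2 * ln (card U)) / \<delta>"
    using delta by (intro divide_right_mono) auto
  moreover have "1 * 1 \<le> ln (card U) * (1 / \<epsilon>)"
    using ln_card_ge_1 inv_eps_gt by (intro mult_mono) auto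
  ultimately show ?thesis by (simp add: query_rate_def)
qed

lemma level_queries_le: "level_queries \<le> 82 * (card U * ln (card U) * (1 / \<epsilon>)\<^sup>2)"
proof -
  define n y z where "n = real (card U)" and "y = ln (card U)" and "z = 1 / \<epsilon>"
  have n: "1 \<le> n" and y: "1 \<le> y" and z: "1 \<le> z"
    using card_ground_ge_1 ln_card_ge_1 inv_eps_gt by (auto simp: n_def y_def z_def)
  have "1 * 1 \<le> y * z\<^sup>2" using y z by (intro mult_mono) auto
  then have "n * 1 \<le> n * (y * z\<^sup>2)" using n by (intro mult_left_mono) auto
  moreover have "query_rate / \<delta> * n \<le> 20 * (y * z) / \<delta> * n"
    using query_rate_le n delta
    by (intro mult_right_mono divide_right_mono) (auto simp: y_def z_def)
  moreover have "20 * (y * z) / \<delta> * n = 80 * (n * (y * z\<^sup>2))" by (simp add: z_def power2_eq_square)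
  moreover have "level_queries = n + 1 + query_rate / \<delta> * n" by (simp add: level_queries_def n_def)
  ultimately have "level_queries \<le> 82 * (n * (y * z\<^sup>2))" using n by linarith
  then show ?thesis by (simp add: n_def y_def z_def mult.assoc)
qed

lemma rounds_le: "l * (1 + real L * (1 + real T)) \<le> round_bound (card U) k \<epsilon>"
proof -
  define x y z where "x = ln k" and "y = ln (card U)" and "z = 1 / \<epsilon>"
  have x: "1 \<le> x" and y: "1 \<le> y" and z: "1 \<le> z"
    using ln_k_ge_1 ln_card_ge_1 inv_eps_gt by (auto simp: x_def y_def z_def)
  have "1 * (1 * 1) \<le> x * (y * z\<^sup>2)" using x y z by (intro mult_mono) auto
  moreover have "real L * (1 + real T) \<le> (10 * x * z) * (7 * (y * z))"
    using num_levels_bound num_batches_bound x z by (intro mult_mono) (auto simp: x_def y_def z_def)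
  ultimately have "1 + real L * (1 + real T) \<le> 71 * (x * (y * z\<^sup>2))"
    by (simp add: power2_eq_square mult_ac)
  then have "l * (1 + real L * (1 + real T)) \<le> (3 * z) * (71 * (x * (y * z\<^sup>2)))"
    using num_stages_bounds(2)[folded z_def] z by (intro mult_mono) auto
  also have "\<dots> = 213 * z ^ 3 * (x * y)" by (simp add: power2_eq_square power3_eq_cube)
  also have "\<dots> \<le> 1000 * z ^ 5 * (x * y)"
    using x y z power_increasing[of 3 5 z] by (intro mult_right_mono mult_mono) auto
  finally show ?thesis by (simp add: round_bound_def x_def y_def z_def power_one_over mult_ac)
qed

lemma queries_le: "l * (real (card U) + 1 + real L * level_queries) \<le> query_bound (card U) k \<epsilon>"
proof -
  define n x y z where "n = real (card U)" and "x = ln k" and "y = ln (card U)" and "z = 1 / \<epsilon>"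
  have n: "1 \<le> n" and x: "1 \<le> x" and y: "1 \<le> y" and z: "1 \<le> z"
    using card_ground_ge_1 ln_k_ge_1 ln_card_ge_1 inv_eps_gt by (auto simp: n_def x_def y_def z_def)
  have "1 * (1 * 1) \<le> x * (y * z ^ 3)" using x y z by (intro mult_mono) auto
  then have "n * 1 \<le> n * (x * (y * z ^ 3))" using n by (intro mult_left_mono) auto
  moreover have "real L * level_queries \<le> (10 * x * z) * (82 * (n * y * z\<^sup>2))"
    using num_levels_bound level_queries_le level_queries_nonneg x z
    by (intro mult_mono) (auto simp: n_def x_def y_def z_def)
  moreover have "(10 * x * z) * (82 * (n * y * z\<^sup>2)) = 820 * (n * (x * (y * z ^ 3)))"
    by (simp add: power2_eq_square power3_eq_cube)
  ultimately have "n + 1 + real L * level_queries \<le> 822 * (n * (x * (y * z ^ 3)))"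
    using n by linarith
  then have "l * (n + 1 + real L * level_queries) \<le> (3 * z) * (822 * (n * (x * (y * z ^ 3))))"
    using num_stages_bounds(2)[folded z_def] z n level_queries_nonneg by (intro mult_mono) auto
  also have "\<dots> = 2466 * z ^ 4 * (n * x * y)" by (simp add: power3_eq_cube power4_eq_xxxx)
  also have "\<dots> \<le> 3000 * z ^ 6 * (n * x * y)"
    using n x y z power_increasing[of 4 6 z] by (intro mult_right_mono mult_mono) auto
  finally show ?thesis
    by (simp add: query_bound_def n_def x_def y_def z_def power_one_over mult_ac)
qed

lemma cost_le_iterate_stage:
  "cost_le f (iterate l stage {}) (round_bound (card U) k \<epsilon>) (query_bound (card U) k \<epsilon>)"
  using cost_le_iterate_boosts[OF stage_boosts[of _ "{}"] cost_le_stage, of l] rounds_le queries_le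
  by (auto intro: cost_le_mono)

end

end

context submodular_fun
begin

lemma iterate_greedy_solves:
  assumes Z: "Z \<subseteq> U" "card Z \<le> k" and k: "3 \<le> k" "2 \<le> k * (exp 1 * \<epsilon>)"
  shows "solves k ((1 / exp 1 - \<epsilon>) * f Z) (iterate k (greedy U k) {})"
proof (rule iterate_boosts_solves)
  have "1 / exp 1 - \<epsilon> \<le> (1 - 2 / k) / exp 1" using k by (simp add: field_simps)
  also have "\<dots> \<le> (1 - 1 / k) ^ (k + 1)" using k by (intro one_minus_inverse_power_ge) auto
  finally show "1 / exp 1 - \<epsilon> \<le> 1 * (1 - 1 / k) ^ (k + 1)" by simp
  show "boosts k 1 1 Z G (outcome f (greedy U k G))" if "G \<subseteq> U" for G
    using that Z k by (intro greedy_boosts) auto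
qed (use Z k in auto)

lemma cost_le_iterate_greedy:
  assumes "0 < \<epsilon>" "\<epsilon> < 1" "3 \<le> k" "3 \<le> card U" and small: "k \<le> 132 * ln k / \<epsilon> ^ 3"
  shows "cost_le f (iterate k (greedy U k) {}) (round_bound (card U) k \<epsilon>) (query_bound (card U) k \<epsilon>)"
proof -
  define x y z where "x = ln k" and "y = ln (card U)" and "z = 1 / \<epsilon>"
  have x: "1 \<le> x" and y: "1 \<le> y" and z: "1 \<le> z"
    using assms ln_ge_1 by (auto simp: x_def y_def z_def)
  have k: "real k \<le> 132 * (z ^ i * y * x)" if "3 \<le> i" for i
  proof -
    have "real k \<le> 132 * (z ^ 3 * 1 * x)" using small by (simp add: x_def z_def power_one_over)
    also have "\<dots> \<le> 132 * (z ^ i * y * x)"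
      using that x y z power_increasing[of 3 i z] by (intro mult_mono) auto
    finally show ?thesis .
  qed
  have nonneg: "0 \<le> z ^ i * y * x" for i using x y z by simp
  have "real k \<le> 1000 * (z ^ 5 * y * x)" using k[of 5] nonneg[of 5] by simp
  then have rounds: "real k * 1 \<le> round_bound (card U) k \<epsilon>"
    by (simp add: round_bound_def x_def y_def z_def power_one_over)
  have "real k * real (card U + 1) \<le> 132 * (z ^ 6 * y * x) * (2 * card U)"
    using k[of 6] nonneg[of 6] assms(4) by (intro mult_mono) auto
  also have "\<dots> \<le> 3000 * (z ^ 6 * y * x) * card U"
    using mult_nonneg_nonneg[OF nonneg[of 6] of_nat_0_le_iff[of "card U"]] by (simp add: mult_ac)
  finally have queries: "real k * real (card U + 1) \<le> query_bound (card U) k \<epsilon>"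
    by (simp add: query_bound_def x_def y_def z_def power_one_over mult_ac)
  have "cost_le f (iterate k (greedy U k) {}) (real k * 1) (real k * real (card U + 1))"
    using assms(3) greedy_boosts[of _ "{}" k] cost_le_greedy by (intro cost_le_iterate_boosts) auto
  then show ?thesis using rounds queries by (rule cost_le_mono)
qed

lemma empty_solves:
  assumes Z: "Z \<subseteq> U" and triv: "U = {} \<or> 1 / exp 1 \<le> \<epsilon>" and eps: "0 < \<epsilon>"
  shows "solves k ((1 / exp 1 - \<epsilon>) * f Z) (Done {})"
proof (cases "U = {}")
  case True
  have "(1 / exp 1 - \<epsilon>) * f {} \<le> 1 * f {}"
    using inverse_exp_1_le eps nonneg[OF empty_subsetI] by (intro mult_right_mono) linarith+
  moreover have "Z = {}" using True Z by simp
  ultimately show ?thesis by (simp add: solves_def)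
next
  case False
  then have "(1 / exp 1 - \<epsilon>) * f Z \<le> 0" using triv nonneg[OF Z] by (intro mult_nonpos_nonneg) auto
  then show ?thesis using nonneg[of "{}"] by (simp add: solves_def)
qed

lemma card_ground_ge_3:
  fixes \<epsilon> :: real
  assumes "0 < \<epsilon>" "\<epsilon> < 1" "3 * (1 / (\<epsilon> * card U)) < 1" "U \<noteq> {}"
  shows "3 \<le> card U"
proof -
  have "0 < card U" using assms(4) finite_ground by (simp add: card_gt_0_iff)
  then have "3 < \<epsilon> * card U" using assms(1,3) by (simp add: divide_less_eq)
  also have "\<dots> \<le> 1 * real (card U)" using assms(2) by (intro mult_right_mono) auto
  finally show ?thesis by simp
qed

lemma
  fixes \<epsilon> :: real and k :: nat
  assumes eps: "0 < \<epsilon>" "\<epsilon> < 1" and k: "0 < k" "\<epsilon> < 1 / exp 1 \<Longrightarrow> 2 \<le> k * (exp 1 * \<epsilon>)"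
  shows maximizer_solves: "Z \<subseteq> U \<Longrightarrow> card Z \<le> k \<Longrightarrow>
      solves k ((1 / exp 1 - \<epsilon>) * f Z) (maximizer U k \<epsilon>)"
    and cost_le_maximizer: "3 * (1 / (\<epsilon> * card U)) < 1 \<Longrightarrow>
      cost_le f (maximizer U k \<epsilon>) (round_bound (card U) k \<epsilon>) (query_bound (card U) k \<epsilon>)"
proof -
  let ?cheap = "\<lambda>P. cost_le f P (round_bound (card U) k \<epsilon>) (query_bound (card U) k \<epsilon>)"
  have "(Z \<subseteq> U \<longrightarrow> card Z \<le> k \<longrightarrow> solves k ((1 / exp 1 - \<epsilon>) * f Z) (maximizer U k \<epsilon>)) \<and>
    (3 * (1 / (\<epsilon> * card U)) < 1 \<longrightarrow> ?cheap (maximizer U k \<epsilon>))"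
  proof (cases "U = {} \<or> 1 / exp 1 \<le> \<epsilon>")
    case True
    have "0 \<le> ln (real (card U))" by (cases "card U = 0") auto
    then show ?thesis
      using True empty_solves[OF _ True eps(1)] eps k
      by (simp add: maximizer_def round_bound_def query_bound_def)
  next
    case False
    then have ground: "U \<noteq> {}" and small_eps: "\<epsilon> < 1 / exp 1" by auto
    note card_ge_3 = card_ground_ge_3[OF eps _ ground]
    have k_eps: "2 \<le> k * (exp 1 * \<epsilon>)" using k(2) small_eps .
    also have "\<dots> < k" using small_eps k(1) by (simp add: less_divide_eq mult.commute)
    finally have k_ge_3: "3 \<le> k" by simp
    show ?thesis
    proof (cases "real k \<le> 132 * ln k / \<epsilon> ^ 3")
      case True
      then have "maximizer U k \<epsilon> = iterate k (greedy U k) {}"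
        using False by (simp add: maximizer_def)
      then show ?thesis
        using iterate_greedy_solves[OF _ _ k_ge_3 k_eps]
          cost_le_iterate_greedy[OF eps k_ge_3 card_ge_3 True] by simp
    next
      case large: False
      interpret parallel_regime U f k \<epsilon>
        using ground eps small_eps inverse_exp_1_le k_ge_3 large by unfold_locales linarith+
      have "maximizer U k \<epsilon> = iterate l stage {}"
        using False large by (simp add: maximizer_def Let_def)
      then show ?thesis using iterate_stage_solves cost_le_iterate_stage[OF card_ge_3] by simp
    qed
  qed
  then show "Z \<subseteq> U \<Longrightarrow> card Z \<le> k \<Longrightarrow> solves k ((1 / exp 1 - \<epsilon>) * f Z) (maximizer U k \<epsilon>)"
    "3 * (1 / (\<epsilon> * card U)) < 1 \<Longrightarrow> ?cheap (maximizer U k \<epsilon>)" by blast+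
qed

end

lemma cardinality_bound_large:
  fixes k l :: nat and \<epsilon> :: real
  assumes eps: "0 < \<epsilon>" "\<epsilon> < 1 / exp 1" and l: "0 < l" "4 / (exp 1 * \<epsilon>) \<le> l" "exp 1 * \<epsilon> * l - 4 \<noteq> 0"
    and k: "(2 - \<epsilon>)\<^sup>2 * l / (exp 1 * \<epsilon> * l - 4) \<le> k"
  shows "2 \<le> k * (exp 1 * \<epsilon>)"
proof -
  have "(3 / 2)\<^sup>2 \<le> (2 - \<epsilon>)\<^sup>2" using eps inverse_exp_1_le by (intro power_mono) linarith+
  then have "9 / 4 * real l \<le> (2 - \<epsilon>)\<^sup>2 * l"
    by (intro mult_right_mono) (auto simp: power2_eq_square)
  also have "\<dots> \<le> k * (exp 1 * \<epsilon> * l - 4)"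
  proof -
    have "0 < exp 1 * \<epsilon> * l - 4" using l eps by (simp add: field_simps)
    then show ?thesis using k by (simp add: divide_le_eq)
  qed
  also have "\<dots> \<le> k * (exp 1 * \<epsilon>) * l" by (simp add: right_diff_distrib)
  finally show ?thesis using l(1) by simp
qed

theorem theorem5p2:
  "\<exists>alg :: 'a set \<Rightarrow> nat \<Rightarrow> real \<Rightarrow> nat \<Rightarrow> 'a oracle_alg.
     \<forall>C_l :: real. \<exists>C_p C_r C_q :: real.
       \<forall>(U :: 'a set) (f :: 'a set \<Rightarrow> real) (n :: nat) (k :: nat) (\<epsilon> :: real) (l :: nat) (Opt :: 'a set).
         finite U \<longrightarrow> card U = n \<longrightarrow>
         (\<forall>S. S \<subseteq> U \<longrightarrow> 0 \<le> f S) \<longrightarrow> submodular_on U f \<longrightarrow>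
         0 < \<epsilon> \<longrightarrow> \<epsilon> < 1 \<longrightarrow> 0 < k \<longrightarrow>
         is_arg_max f (\<lambda>S. S \<subseteq> U \<and> card S \<le> k) Opt \<longrightarrow>
         0 < l \<longrightarrow> real l \<le> C_l / \<epsilon> \<longrightarrow> real l \<ge> 4 / (exp 1 * \<epsilon>) \<longrightarrow>
         exp 1 * \<epsilon> * real l - 4 \<noteq> 0 \<longrightarrow>
         real k \<ge> (2 - \<epsilon>)\<^sup>2 * real l / (exp 1 * \<epsilon> * real l - 4) \<longrightarrow>
         queries_within U (alg U k \<epsilon> l) \<and>
         (\<forall>(G, r, q) \<in> set_pmf (run f (alg U k \<epsilon> l)). G \<subseteq> U \<and> card G \<le> k) \<and>
         measure_pmf.expectation (run f (alg U k \<epsilon> l)) (\<lambda>(G, r, q). f G)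
           \<ge> (1 / exp 1 - \<epsilon>) * f Opt \<and>
         measure_pmf.prob (run f (alg U k \<epsilon> l))
           {(G, r, q). real r \<le> C_r * (1 / \<epsilon> ^ 5) * ln (real n) * ln (real k) \<and>
                       real q \<le> C_q * (1 / \<epsilon> ^ 6) * real n * ln (real n) * ln (real k)}
           \<ge> 1 - C_p * (1 / (\<epsilon> * real n))"
proof (rule exI[of _ "\<lambda>U k \<epsilon> l. compile (maximizer U k \<epsilon>)"], rule allI,
    rule exI[of _ 3], rule exI[of _ 1000], rule exI[of _ 3000], intro allI impI conjI)
  fix C_l \<epsilon> :: real and U Opt :: "'a set" and f :: "'a set \<Rightarrow> real" and n k l :: nat
  assume U: "finite U" "card U = n" and f: "\<forall>S. S \<subseteq> U \<longrightarrow> 0 \<le> f S" "submodular_on U f"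
    and eps: "0 < \<epsilon>" "\<epsilon> < 1" and k: "0 < k" and Opt: "is_arg_max f (\<lambda>S. S \<subseteq> U \<and> card S \<le> k) Opt"
    and l: "0 < l" "real l \<ge> 4 / (exp 1 * \<epsilon>)" "exp 1 * \<epsilon> * real l - 4 \<noteq> 0"
    and k_ge: "real k \<ge> (2 - \<epsilon>)\<^sup>2 * real l / (exp 1 * \<epsilon> * real l - 4)"
  interpret submodular_fun U f using U f by unfold_locales auto
  let ?alg = "compile (maximizer U k \<epsilon>)"
  note parameters = eps k cardinality_bound_large[OF eps(1) _ l k_ge]
  have solves: "solves k ((1 / exp 1 - \<epsilon>) * f Opt) (maximizer U k \<epsilon>)"
    using Opt by (intro maximizer_solves parameters) (auto simp: is_arg_max_def)
  show "queries_within U ?alg" by (intro queries_within_compile legal_maximizer)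
  show "\<forall>(G, r, q) \<in> set_pmf (run f ?alg). G \<subseteq> U \<and> card G \<le> k"
    using solves by (auto simp: solves_def dest: outcome_run_compile)
  show "(1 / exp 1 - \<epsilon>) * f Opt \<le> measure_pmf.expectation (run f ?alg) (\<lambda>(G, r, q). f G)"
    using solves by (simp add: solves_def expectation_run_compile)
  show "1 - 3 * (1 / (\<epsilon> * real n)) \<le> measure_pmf.prob (run f ?alg)
      {(G, r, q). real r \<le> 1000 * (1 / \<epsilon> ^ 5) * ln (real n) * ln (real k) \<and>
                  real q \<le> 3000 * (1 / \<epsilon> ^ 6) * real n * ln (real n) * ln (real k)}"
    unfolding U(2)[symmetric] round_bound_def[symmetric] query_bound_def[symmetric]
    by (intro prob_cost_run_compile_ge cost_le_maximizer parameters) (use eps in auto)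
qed

end
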